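(* Let $1/2<\sigma<1$ and $0<\delta\leq \sigma$. If the asymptotic formula $$\frac{1}{T}\int_{T}^{2T}|\zeta(\sigma+it)|^{2k}dt= (1+o(1))\sum_{n=1}^{\infty}\frac{d_k(n)^2}{n^{2\sigma}}\qquad (T\to\infty)\qquad (\ast)$$ holds for all positive integers $k\leq (\log T)^{\delta}$, then $L_T(\sigma)\ll (\log T)^{1-\delta}$. Conversely, if $L_T(\beta)\ll (\log T)^{1-\delta}$ for all $\beta \geq \sigma-1/\log_2 T$, then $(\ast)$ holds for all positive integers $k\leq c(\log T)^{\delta}/\log_2 T$, where $c>0$ is a suitably small constant.
   Context: $L_T(\sigma):=\max_{t\in [T,2T]}\log |\zeta(\sigma+it)|$. $d_k(n)$ is the $k$-fold divisor function, i.e. the multiplicative function with $d_k(p^a)=\Gamma(k+a)/(\Gamma(k)a!)$. $\log_2=\log\log$. *)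

theory Defs
  imports "HOL-Analysis.Analysis" "HOL-Computational_Algebra.Primes"
begin

text \<open>Riemann zeta function on the half-plane Re s > 0, s \<noteq> 1, via its standard
  analytic continuation  zeta s = s/(s-1) - s * integral_1^infty frac(x) x^(-s-1) dx
  (for Re s > 1 this agrees with the Dirichlet series sum n^(-s)).\<close>
definition zeta :: "complex \<Rightarrow> complex" where
  "zeta s = s / (s - 1)
     - s * integral {1..} (\<lambda>x::real. of_real (frac x) / (of_real x) powr (s + 1))"

definition dk :: "real \<Rightarrow> nat \<Rightarrow> real" where
  "dk k n = (\<Prod>p\<in>prime_factors n.
     Gamma (k + real (multiplicity p n)) / (Gamma k * fact (multiplicity p n)))"

text \<open>L_T(sigma) = max over t in [T,2T] of log |zeta(sigma+it)| (zeros of zeta, where the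
  logarithm is -infinity, do not contribute to the maximum).\<close>
definition LT :: "real \<Rightarrow> real \<Rightarrow> real" where
  "LT T \<sigma> = (SUP t\<in>{t. T \<le> t \<and> t \<le> 2*T \<and> zeta (Complex \<sigma> t) \<noteq> 0}.
                 ln (cmod (zeta (Complex \<sigma> t))))"

definition moment :: "real \<Rightarrow> nat \<Rightarrow> real \<Rightarrow> real" where
  "moment \<sigma> k T = (1 / T) * integral {T..2*T} (\<lambda>t. cmod (zeta (Complex \<sigma> t)) ^ (2*k))"

definition diag_sum :: "real \<Rightarrow> nat \<Rightarrow> real" where
  "diag_sum \<sigma> k = (\<Sum>n. (dk (real k) (Suc n))\<^sup>2 / real (Suc n) powr (2*\<sigma>))"

definition moment_asymp :: "real \<Rightarrow> (real \<Rightarrow> real) \<Rightarrow> bool" where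
  "moment_asymp \<sigma> K \<longleftrightarrow>
     (\<forall>\<epsilon>>0. \<exists>T0. \<forall>T\<ge>T0. \<forall>k::nat. 1 \<le> k \<and> real k \<le> K T \<longrightarrow>
        \<bar>moment \<sigma> k T - diag_sum \<sigma> k\<bar> \<le> \<epsilon> * diag_sum \<sigma> k)"

end

theory Submission
  imports Defs "HOL-Complex_Analysis.Complex_Analysis" "HOL-Real_Asymp.Real_Asymp"
begin

text \<open>
  If the moment formula holds for \<open>k \<approx> (log T)\<^sup>\<delta>\<close>, then, since \<open>|\<zeta>'| \<lless> T\<close> on the
  line, a peak \<open>M\<close> of \<open>|\<zeta>(\<sigma> + it)|\<close> persists on an interval of length \<open>\<ggreater> 1/T\<close>, so
  \<open>(M/2)\<^bsup>2k\<^esup> \<lless> T\<^sup>2 \<Sum> d\<^sub>k(n)\<^sup>2 n\<^bsup>-2\<sigma>\<^esup>\<close>. The Euler product shows that the logarithm of the last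
  sum is \<open>O(k\<^bsup>1/\<sigma>\<^esup>)\<close>, which is \<open>O(k (log T)\<^bsup>1-\<delta>\<^esup>)\<close> because \<open>\<delta> \<le> \<sigma>\<close>.

  Conversely, \<open>\<zeta>(s)\<^sup>k\<close> is the integral of \<open>\<zeta>(s+w)\<^sup>k X\<^sup>w exp(w\<^sup>2)/w\<close> over the boundary of
  the rectangle with real parts between \<open>-\<alpha>\<close> and \<open>3\<close> and height \<open>2 log T\<close>, where
  \<open>\<alpha> = 1/(2 log\<^sub>2 T)\<close> and \<open>X = T\<^bsup>1/20\<^esup>\<close>. The right side is a smoothed Dirichlet series, whose
  mean square over \<open>[T,2T]\<close> is its diagonal up to a negligible error. On the left side the factor
  \<open>X\<^bsup>-\<alpha>\<^esup> = exp(-log T/(40 log\<^sub>2 T))\<close> beats \<open>|\<zeta>|\<^sup>k \<le> exp(O(c log T/log\<^sub>2 T))\<close>. The same contour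
  applied to \<open>n\<^bsup>-w\<^esup>\<close> shows that the smoothing weights are close to \<open>1\<close>.
\<close>

section \<open>Analytic continuation of zeta\<close>

text \<open>Two opposite demands fix the constants in the converse. A right edge at real part 3
  makes the smoothing weights decay like \<open>n powr (-3)\<close>, so off the diagonal the trivial
  bound \<open>1 / |log (m/n)| <= m * n\<close> suffices and no estimate depends on the number of
  terms kept; the price is a factor \<open>X^6 / T\<close>, harmless for
  \<open>X = T powr (1/20)\<close>. The left edge must lie far enough to the left for
  \<open>X powr (-\<alpha>)\<close> to win, yet after the shift the exponent
  \<open>k powr (1 / (\<sigma> - \<alpha>))\<close> of the diagonal sum should exceed
  \<open>k powr (1 / \<sigma>)\<close> only by a constant factor. A shift of order
  \<open>1 / log log T\<close> meets both, and this is where the \<open>log log T\<close> lost in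
  the range of k comes from. The shift is half the width in the hypothesis because the contour
  leaves [T, 2T] by up to \<open>log T\<close>, so that the pointwise bound is also needed on the
  windows starting at T/2 and 2T. The Gaussian factor permits cutting at height
  \<open>log T\<close>, since \<open>exp (-(log T)^2)\<close> outweighs every power of T. All
  estimates are explicit in k, which gives the uniformity required.\<close>

definition zeta_partial :: "nat \<Rightarrow> complex \<Rightarrow> complex" where
  "zeta_partial N s = (\<Sum>n=1..N. of_nat n powr (-s)) + of_nat N powr (1 - s) / (s - 1)"

text \<open>The term \<open>N powr (1 - s) / (s - 1)\<close> is the integral of
  \<open>x powr (-s)\<close> over x > N when Re s > 1. With it, the step from n to n + 1 is exactly
  a fractional-part integral over [n, n + 1], which keeps \<open>zeta_partial\<close> convergent
  down to Re s > 0.\<close>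

lemma zeta_partial_has_integral_unit:
  assumes "n \<ge> 1" "s \<noteq> 1"
  shows "((\<lambda>x::real. s * (of_real (frac x) / of_real x powr (s + 1)))
           has_integral (zeta_partial n s - zeta_partial (Suc n) s)) {real n..real (Suc n)}"
proof -
  \<comment> \<open>An antiderivative of \<open>s * (z - n) * z powr (-s - 1)\<close>, because
    \<open>frac x = x - n\<close> on [n, n + 1).\<close>
  define G where "G = (\<lambda>z::complex. s * z powr (1 - s) / (1 - s) + of_nat n * z powr (- s))"
  have der: "((\<lambda>x. G (of_real x)) has_vector_derivative
                s * ((of_real x - of_nat n) / of_real x powr (s + 1)))
              (at x within {real n..real (Suc n)})" if "x \<in> {real n..real (Suc n)}" for x
  proof (rule has_vector_derivative_real_field)
    have x: "x > 0" using that assms by auto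
    have ps: "complex_of_real x powr (- s - 1) = 1 / of_real x powr (s + 1)"
      using powr_minus[of "complex_of_real x" "s + 1"] by (simp only: inverse_eq_divide minus_add_distrib diff_conv_add_uminus)
    have ps2: "complex_of_real x powr (1 - s - 1) = of_real x / of_real x powr (s + 1)"
    proof -
      have "complex_of_real x powr (1 - s - 1) = of_real x powr (1 + (- s - 1))" by simp
      also have "\<dots> = of_real x powr 1 * of_real x powr (- s - 1)" by (rule powr_add)
      finally show ?thesis using ps x by simp
    qed
    have "(G has_field_derivative
             s * ((1 - s) * of_real x powr (1 - s - 1)) / (1 - s)
               + of_nat n * ((- s) * of_real x powr (- s - 1))) (at (of_real x))"
      unfolding G_def using x assms
      by (intro DERIV_add DERIV_cmult DERIV_cdivide has_field_derivative_powr)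
         (auto simp: complex_nonpos_Reals_iff)
    also have "s * ((1 - s) * of_real x powr (1 - s - 1)) / (1 - s)
               + of_nat n * ((- s) * of_real x powr (- s - 1)) =
               s * ((of_real x - of_nat n) / of_real x powr (s + 1))"
    proof -
      have eq: "s * ((1 - s) * P) / (1 - s) = s * P" for P :: complex
        using assms by simp
      show ?thesis unfolding ps ps2 eq by (simp add: diff_divide_distrib right_diff_distrib)
    qed
    finally show "(G has_field_derivative s * ((of_real x - of_nat n) / of_real x powr (s + 1)))
              (at (of_real x))" .
  qed
  have I: "((\<lambda>x::real. s * ((of_real x - of_nat n) / of_real x powr (s + 1)))
           has_integral (G (of_real (real (Suc n))) - G (of_real (real n)))) {real n..real (Suc n)}"
    by (rule fundamental_theorem_of_calculus) (use der in auto)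
  have val: "G (of_real (real (Suc n))) - G (of_real (real n))
           = zeta_partial n s - zeta_partial (Suc n) s"
  proof -
    have e1: "complex_of_nat m powr (1 - s) = of_nat m * of_nat m powr (- s)" if "m > 0" for m
      using powr_add[of "complex_of_nat m" 1 "- s"] that by simp
    have "n > 0" using assms by simp
    have e2: "(1 + complex_of_nat n) powr (1 - s) = (1 + of_nat n) * (1 + of_nat n) powr (- s)"
      using e1[of "Suc n"] by simp
    show ?thesis
      unfolding G_def zeta_partial_def of_real_of_nat_eq
      using \<open>n > 0\<close> assms(2) by (simp add: e1 e2 divide_simps) (simp add: algebra_simps)
  qed
  \<comment> \<open>At x = n + 1 the fractional part drops to 0, so this point is excepted.\<close>
  have "((\<lambda>x::real. s * (of_real (frac x) / of_real x powr (s + 1)))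
           has_integral (G (of_real (real (Suc n))) - G (of_real (real n)))) {real n..real (Suc n)}"
  proof (rule has_integral_spike_finite[OF _ _ I, of "{real (Suc n)}"])
    fix x assume "x \<in> {real n..real (Suc n)} - {real (Suc n)}"
    then have "\<lfloor>x\<rfloor> = int n" by (auto simp: floor_eq_iff)
    then have "frac x = x - real n" by (simp add: frac_def)
    then show "s * (of_real (frac x) / of_real x powr (s + 1)) =
               s * ((of_real x - of_nat n) / of_real x powr (s + 1))" by simp
  qed auto
  then show ?thesis unfolding val .
qed

lemma zeta_partial_has_integral:
  assumes "N \<ge> 1" "s \<noteq> 1"
  shows "((\<lambda>x::real. s * (of_real (frac x) / of_real x powr (s + 1)))
           has_integral (s / (s - 1) - zeta_partial N s)) {1..real N}"
  using assms(1)
proof (induction N rule: dec_induct)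
  case base
  have "zeta_partial 1 s = s / (s - 1)"
    using assms(2) by (simp add: zeta_partial_def field_simps)
  then show ?case using has_integral_refl(2)[of _ "1::real"] by simp
next
  case (step n)
  have "((\<lambda>x::real. s * (of_real (frac x) / of_real x powr (s + 1)))
           has_integral ((s / (s - 1) - zeta_partial n s) + (zeta_partial n s - zeta_partial (Suc n) s)))
         {1..real (Suc n)}"
    using step.hyps by (intro has_integral_combine[OF _ _ step.IH zeta_partial_has_integral_unit])
       (use assms in auto)
  then show ?case by simp
qed

lemma norm_zeta_integrand_le:
  assumes "x \<ge> 1"
  shows "norm (of_real (frac x) / complex_of_real x powr (s + 1)) \<le> x powr (- Re s - 1)"
proof -
  have "norm (of_real (frac x) / complex_of_real x powr (s + 1)) = \<bar>frac x\<bar> / x powr (Re s + 1)"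
    using assms by (simp add: norm_divide norm_powr_real_powr)
  also have "\<dots> \<le> 1 / x powr (Re s + 1)"
    using assms frac_lt_1[of x] frac_ge_0[of x] by (intro divide_right_mono) auto
  also have "\<dots> = x powr (- Re s - 1)"
    using powr_minus[of x "Re s + 1"]
    by (simp only: inverse_eq_divide minus_add_distrib diff_conv_add_uminus)
  finally show ?thesis .
qed

lemma powr_integrable_tail:
  assumes "Re s > 0"
  shows "((\<lambda>x::real. x powr (- Re s - 1)) has_integral 1 / Re s) {1..}"
  using has_integral_powr_to_inf[of "- Re s - 1" 1] assms by simp

text \<open>The truncated integrals converge by domination, as \<open>frac\<close> is below 1 and
  the integrand is at most \<open>x powr (- Re s - 1)\<close>. The same majorant yields a bound
  linear in |s|, the only a priori growth estimate for zeta on which the rest relies.\<close>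

lemma
  assumes "Re s > 0" "s \<noteq> 1"
  shows zeta_partial_tendsto: "(\<lambda>N. zeta_partial N s) \<longlonglongrightarrow> zeta s"
    and norm_zeta_le: "norm (zeta s) \<le> norm s / norm (s - 1) + norm s / Re s"
proof -
  define f where "f = (\<lambda>x::real. of_real (frac x) / complex_of_real x powr (s + 1))"
  define F where "F = (\<lambda>k::nat. \<lambda>x::real. if x \<in> {1..real k} then f x else 0)"
  have s0: "s \<noteq> 0" using assms by auto
  have hi: "(f has_integral (s / (s - 1) - zeta_partial N s) / s) {1..real N}" if "N \<ge> 1" for N
    using has_integral_mult_right[OF zeta_partial_has_integral[OF that assms(2)], of "1/s"] s0
    by (simp add: f_def)
  have sub: "{1..real k} \<subseteq> {1..}" for k by auto
  have Fint: "(F k has_integral (if k \<ge> 1 then (s / (s - 1) - zeta_partial k s) / s else 0)) {1..}" for k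
  proof (cases "k \<ge> 1")
    case True
    show ?thesis using has_integral_restrict[OF sub, of k f] hi[OF True] True by (simp add: F_def)
  next
    case False
    then have "F k = (\<lambda>x. 0)" by (auto simp: F_def fun_eq_iff)
    then show ?thesis using False by simp
  qed
  have hint: "(\<lambda>x::real. x powr (- Re s - 1)) integrable_on {1..}"
    using powr_integrable_tail[OF assms(1)] by blast
  have dc: "f integrable_on {1..} \<and> (\<lambda>k. integral {1..} (F k)) \<longlonglongrightarrow> integral {1..} f"
  proof -
    have 1: "F k integrable_on {1..}" for k using Fint by blast
    have 2: "norm (F k x) \<le> x powr (- Re s - 1)" if "x \<in> {1..}" for k x
      using norm_zeta_integrand_le[of x s] that by (auto simp: F_def f_def)
    have 3: "(\<lambda>k. F k x) \<longlonglongrightarrow> f x" if "x \<in> {1..}" for x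
    proof (rule tendsto_eventually)
      show "\<forall>\<^sub>F k in sequentially. F k x = f x"
        using eventually_ge_at_top[of "nat \<lceil>x\<rceil>"]
      proof eventually_elim
        case (elim k)
        then have "x \<le> real k" by linarith
        then show ?case using that by (simp add: F_def)
      qed
    qed
    show ?thesis
      using dominated_convergence[OF 1 hint 2 3] by auto
  qed
  have z: "zeta s = s / (s - 1) - s * integral {1..} f" by (simp add: zeta_def f_def)
  have "(\<lambda>k. s / (s - 1) - s * integral {1..} (F k)) \<longlonglongrightarrow> zeta s"
    unfolding z using dc by (intro tendsto_intros) auto
  then show "(\<lambda>N. zeta_partial N s) \<longlonglongrightarrow> zeta s"
  proof (rule Lim_transform_eventually)
    show "\<forall>\<^sub>F k in sequentially. s / (s - 1) - s * integral {1..} (F k) = zeta_partial k s"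
      using eventually_ge_at_top[of 1]
    proof eventually_elim
      case (elim k)
      have "integral {1..} (F k) = (s / (s - 1) - zeta_partial k s) / s"
        using Fint[of k] elim by (simp add: integral_unique)
      then show ?case using s0 by (simp add: field_simps)
    qed
  qed
  have "norm (integral {1..} f) \<le> integral {1..} (\<lambda>x::real. x powr (- Re s - 1))"
    using dc hint norm_zeta_integrand_le[of _ s]
    by (intro integral_norm_bound_integral) (auto simp: f_def)
  also have "\<dots> = 1 / Re s" using powr_integrable_tail[OF assms(1)] by (rule integral_unique)
  finally have "norm (s * integral {1..} f) \<le> norm s * (1 / Re s)"
    unfolding norm_mult by (rule mult_left_mono) simp
  then show "norm (zeta s) \<le> norm s / norm (s - 1) + norm s / Re s"
    unfolding z using norm_triangle_ineq4[of "s / (s - 1)" "s * integral {1..} f"]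
    by (simp add: norm_divide)
qed

lemma norm_zeta_partial_diff_le:
  assumes "n \<ge> 1" "s \<noteq> 1" "Re s > 0"
  shows "norm (zeta_partial (Suc n) s - zeta_partial n s) \<le> norm s * real n powr (- Re s - 1)"
proof -
  have "norm (zeta_partial n s - zeta_partial (Suc n) s)
     \<le> norm s * real n powr (- Re s - 1) * (real (Suc n) - real n)"
  proof (rule has_integral_bound_real[OF _ _ zeta_partial_has_integral_unit[OF assms(1,2)], of _ "{}", THEN order_trans])
    show "0 \<le> norm s * real n powr (- Re s - 1)" by simp
    fix x assume "x \<in> {real n..real (Suc n)} - {}"
    then have x: "x \<in> {real n..real (Suc n)}" by simp
    have "norm (of_real (frac x) / complex_of_real x powr (s + 1)) \<le> x powr (- Re s - 1)"
      using x assms by (intro norm_zeta_integrand_le) auto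
    also have "\<dots> \<le> real n powr (- Re s - 1)"
      using x assms by (intro powr_mono2') auto
    finally show "norm (s * (of_real (frac x) / complex_of_real x powr (s + 1)))
        \<le> norm s * real n powr (- Re s - 1)"
      unfolding norm_mult by (intro mult_left_mono) auto
  qed auto
  then show ?thesis by (simp add: norm_minus_commute)
qed

text \<open>Holomorphy is inherited from the approximants through locally uniform convergence: their
  consecutive differences are at most \<open>norm s * n powr (- Re s - 1)\<close>, so the M-test
  applies on closed discs, where Re s has a positive minimum.\<close>

lemma zeta_holomorphic: "zeta holomorphic_on {s. Re s > 0} - {1}"
proof -
  define S where "S = {s. Re s > 0} - {1::complex}"
  have opS: "open S" unfolding S_def by (intro open_Diff open_halfspace_Re_gt) auto
  have "zeta holomorphic_on S"
  proof (rule holomorphic_uniform_sequence[OF opS])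
    fix n show "zeta_partial n holomorphic_on S"
    proof (cases "n = 0")
      case True
      \<comment> \<open>\<open>0 powr z\<close> is 0 by convention, so the approximant with N = 0
        vanishes.\<close>
      then have "zeta_partial n = (\<lambda>s. 0)" by (simp add: zeta_partial_def fun_eq_iff)
      then show ?thesis by simp
    next
      case False
      have "(\<lambda>s. (\<Sum>n=1..n. of_nat n powr (-s)) + of_nat n powr (1 - s) / (s - 1)) holomorphic_on S"
        using False by (intro holomorphic_intros) (auto simp: S_def)
      then show ?thesis by (simp add: zeta_partial_def[abs_def])
    qed
  next
    fix x assume "x \<in> S"
    then obtain d where d: "d > 0" "cball x d \<subseteq> S"
      using opS open_contains_cball by blast
    have "compact (Re ` cball x d)"
      by (intro compact_continuous_image continuous_intros) auto
    moreover have "Re ` cball x d \<noteq> {}" using d by auto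
    ultimately obtain b where b: "b \<in> cball x d" "\<And>y. y \<in> cball x d \<Longrightarrow> Re b \<le> Re y"
      using compact_attains_inf[of "Re ` cball x d"] by auto
    have b0: "Re b > 0" using b(1) d(2) by (auto simp: S_def)
    define R where "R = norm x + d"
    have R: "norm y \<le> R" if "y \<in> cball x d" for y
      using that norm_triangle_ineq2[of y x] by (auto simp: R_def dist_norm norm_minus_commute)
    define a where "a = (\<lambda>n y. zeta_partial (Suc (Suc n)) y - zeta_partial (Suc n) y)"
    have "summable (\<lambda>n. R * real (Suc n) powr (- Re b - 1))"
    proof (intro summable_mult)
      have "summable (\<lambda>n. real n powr (- Re b - 1))" using b0 by (simp add: summable_real_powr_iff)
      then show "summable (\<lambda>n. real (Suc n) powr (- Re b - 1))" by (subst summable_Suc_iff)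
    qed
    moreover have "norm (a n y) \<le> R * real (Suc n) powr (- Re b - 1)" if y: "y \<in> cball x d" for n y
    proof -
      have yS: "Re y > 0" "y \<noteq> 1" using y d by (auto simp: S_def)
      have "norm (a n y) \<le> norm y * real (Suc n) powr (- Re y - 1)"
        unfolding a_def using yS by (intro norm_zeta_partial_diff_le) auto
      also have "\<dots> \<le> R * real (Suc n) powr (- Re b - 1)"
        using R[OF y] b(2)[OF y] norm_ge_zero[of y] order_trans[OF norm_ge_zero R[OF y]] by (intro mult_mono powr_mono) auto
      finally show ?thesis .
    qed
    ultimately have ul: "uniform_limit (cball x d) (\<lambda>n y. \<Sum>i<n. a i y) (\<lambda>y. suminf (\<lambda>i. a i y)) sequentially"
      by (intro Weierstrass_m_test[rotated])
    have tele: "(\<Sum>i<n. a i y) = zeta_partial (Suc n) y - zeta_partial 1 y" for n y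
      unfolding a_def using sum_lessThan_telescope[of "\<lambda>n. zeta_partial (Suc n) y" n] by simp
    have lim: "suminf (\<lambda>i. a i y) = zeta y - zeta_partial 1 y" if "y \<in> cball x d" for y
    proof -
      have "(\<lambda>n. zeta_partial (Suc n) y) \<longlonglongrightarrow> zeta y"
        using that d by (intro LIMSEQ_Suc zeta_partial_tendsto) (auto simp: S_def)
      then have "(\<lambda>n. \<Sum>i<n. a i y) \<longlonglongrightarrow> zeta y - zeta_partial 1 y"
        unfolding tele by (intro tendsto_intros)
      then show ?thesis by (simp add: sums_def sums_unique[symmetric])
    qed
    have "uniform_limit (cball x d) (\<lambda>n y. zeta_partial (Suc n) y) zeta sequentially"
    proof -
      have "uniform_limit (cball x d) (\<lambda>n y. (\<Sum>i<n. a i y) + zeta_partial 1 y)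
              (\<lambda>y. suminf (\<lambda>i. a i y) + zeta_partial 1 y) sequentially"
        by (intro uniform_limit_add ul uniform_limit_const)
      then show ?thesis unfolding tele
        by (rule uniform_limit_cong'[THEN iffD1, rotated -1]) (auto simp: lim)
    qed
    then have "uniform_limit (cball x d) zeta_partial zeta sequentially"
      unfolding uniform_limit_iff by (subst (asm) eventually_sequentially_Suc)
    then show "\<exists>d>0. cball x d \<subseteq> S \<and> uniform_limit (cball x d) zeta_partial zeta sequentially"
      using d by blast
  qed
  then show ?thesis by (simp add: S_def)
qed

lemma zeta_sums:
  assumes "Re s > 1"
  shows "(\<lambda>n. of_nat (Suc n) powr (-s)) sums zeta s"
proof -
  have 0: "(\<lambda>N. of_nat N powr (1 - s) / (s - 1)) \<longlonglongrightarrow> 0"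
  proof (rule tendsto_norm_zero_cancel)
    have "(\<lambda>N. real N powr (1 - Re s)) \<longlonglongrightarrow> 0"
      using assms by (intro tendsto_neg_powr filterlim_real_sequentially) auto
    then have "(\<lambda>N. real N powr (1 - Re s) / norm (s - 1)) \<longlonglongrightarrow> 0 / norm (s - 1)"
      using assms by (intro tendsto_divide) auto
    then show "(\<lambda>N. norm (of_nat N powr (1 - s) / (s - 1))) \<longlonglongrightarrow> 0"
      by (simp add: norm_divide norm_powr_real_powr)
  qed
  have "(\<lambda>N. zeta_partial N s - of_nat N powr (1 - s) / (s - 1)) \<longlonglongrightarrow> zeta s - 0"
    using assms by (intro tendsto_diff 0 zeta_partial_tendsto) auto
  moreover have "zeta_partial N s - of_nat N powr (1 - s) / (s - 1) = (\<Sum>n<N. of_nat (Suc n) powr (-s))" for N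
    unfolding zeta_partial_def using sum.shift_bounds_Suc_ivl[of "\<lambda>n. of_nat n powr (-s)" 0 N]
    by (simp add: atLeast0LessThan atLeastLessThanSuc_atLeastAtMost)
  ultimately show ?thesis by (simp add: sums_def)
qed

section \<open>The divisor functions and the diagonal sum\<close>

text \<open>Writing k = j + 1 turns the Gamma quotient into a binomial coefficient and keeps clear
  of the pole of Gamma at 0.\<close>

lemma dk_Suc:
  "dk (real (Suc j)) n =
     (\<Prod>p\<in>prime_factors n. real ((j + multiplicity p n) choose multiplicity p n))"
proof -
  have "Gamma (real (Suc j) + real a) / (Gamma (real (Suc j)) * fact a) = real ((j + a) choose a)" for a
  proof -
    have "Gamma (real (Suc j) + real a) = fact (j + a)" "Gamma (real (Suc j)) = (fact j :: real)"
      using Gamma_fact[of "j + a", where ?'a = real] Gamma_fact[of j, where ?'a = real]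
      by (simp_all add: add_ac)
    then show ?thesis
      using binomial_fact[of a "j + a", where ?'a = real] by (simp add: mult_ac)
  qed
  then show ?thesis unfolding dk_def by (intro prod.cong) auto
qed

lemma prod_prime_factors_extend:
  fixes h :: "nat \<Rightarrow> nat \<Rightarrow> 'a :: comm_monoid_mult"
  assumes "finite P" "prime_factors n \<subseteq> P" "\<And>p. p \<in> P \<Longrightarrow> prime p" "\<And>p. h p 0 = 1"
  shows "(\<Prod>p\<in>prime_factors n. h p (multiplicity p n)) = (\<Prod>p\<in>P. h p (multiplicity p n))"
proof (rule prod.mono_neutral_left)
  show "\<forall>p\<in>P - prime_factors n. h p (multiplicity p n) = 1"
    using assms by (metis Diff_iff count_prime_factorization_prime not_in_iff)
qed (use assms in auto)

text \<open>A divisor of n is a choice, for each prime of n, of an exponent up to that in n;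
  expanding the product over these choices gives the sum.\<close>

lemma sum_divisors_prod_prime_factors:
  fixes h :: "nat \<Rightarrow> nat \<Rightarrow> 'a :: comm_semiring_1"
  assumes "n > 0" "\<And>p. h p 0 = 1"
  shows "(\<Sum>d | d dvd n. \<Prod>p\<in>prime_factors d. h p (multiplicity p d))
           = (\<Prod>p\<in>prime_factors n. \<Sum>a\<le>multiplicity p n. h p a)"
proof -
  define P where "P = prime_factors n"
  have P: "finite P" "\<And>p. p \<in> P \<Longrightarrow> prime p" by (auto simp: P_def)
  define B where "B = PiE P (\<lambda>p. {..multiplicity p n})"
  have "(\<Prod>p\<in>P. \<Sum>a\<le>multiplicity p n. h p a) = (\<Sum>e\<in>B. \<Prod>p\<in>P. h p (e p))"
    unfolding B_def using P by (intro prod_sum_PiE) auto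
  also have "\<dots> = (\<Sum>d | d dvd n. \<Prod>p\<in>prime_factors d. h p (multiplicity p d))"
  proof (rule sum.reindex_bij_witness[of _ "\<lambda>d. restrict (\<lambda>p. multiplicity p d) P"
            "\<lambda>e. \<Prod>p\<in>P. p ^ e p"])
    fix e assume e: "e \<in> B"
    have mul: "multiplicity p (\<Prod>p\<in>P. p ^ e p) = (if p \<in> P then e p else 0)" if "prime p" for p
      using P that by (intro multiplicity_prod_prime_powers) auto
    show "restrict (\<lambda>p. multiplicity p (\<Prod>p\<in>P. p ^ e p)) P = e"
      using e P mul by (auto simp: B_def PiE_def extensional_def fun_eq_iff)
    show "(\<Prod>p\<in>P. p ^ e p) \<in> {d. d dvd n}"
    proof -
      have "(\<Prod>p\<in>P. p ^ e p) dvd n"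
      proof (rule multiplicity_le_imp_dvd)
        show "(\<Prod>p\<in>P. p ^ e p) \<noteq> 0" using P by (auto dest: prime_gt_0_nat)
        show "multiplicity p (\<Prod>p\<in>P. p ^ e p) \<le> multiplicity p n" if "prime p" for p
          using mul[OF that] e by (auto simp: B_def)
      qed
      then show ?thesis by simp
    qed
    then have d: "(\<Prod>p\<in>P. p ^ e p) dvd n" by simp
    have "prime_factors (\<Prod>p\<in>P. p ^ e p) \<subseteq> P"
      unfolding P_def using d assms(1) by (intro dvd_prime_factors) (auto simp: P_def)
    then have "(\<Prod>p\<in>prime_factors (\<Prod>p\<in>P. p ^ e p). h p (multiplicity p (\<Prod>p\<in>P. p ^ e p)))
         = (\<Prod>p\<in>P. h p (multiplicity p (\<Prod>p\<in>P. p ^ e p)))"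
      using P assms by (intro prod_prime_factors_extend) auto
    also have "\<dots> = (\<Prod>p\<in>P. h p (e p))"
      using P mul by (intro prod.cong) auto
    finally show "(\<Prod>p\<in>prime_factors (\<Prod>p\<in>P. p ^ e p). h p (multiplicity p (\<Prod>p\<in>P. p ^ e p)))
         = (\<Prod>p\<in>P. h p (e p))" .
  next
    fix d assume "d \<in> {d. d dvd n}"
    then have d: "d dvd n" by simp
    then have d0: "d \<noteq> 0" using assms by auto
    have sub: "prime_factors d \<subseteq> P"
      unfolding P_def using d assms(1) by (intro dvd_prime_factors) auto
    show "(\<Prod>p\<in>P. p ^ restrict (\<lambda>p. multiplicity p d) P p) = d"
    proof -
      have "(\<Prod>p\<in>P. p ^ restrict (\<lambda>p. multiplicity p d) P p) = (\<Prod>p\<in>P. p ^ multiplicity p d)"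
        by (intro prod.cong) auto
      also have "\<dots> = (\<Prod>p\<in>prime_factors d. p ^ multiplicity p d)"
        using P sub by (intro prod_prime_factors_extend[symmetric, where h = "\<lambda>p a. p ^ a"]) auto
      also have "\<dots> = d" using prime_factorization_nat[of d] d0 by simp
      finally show ?thesis .
    qed
    show "restrict (\<lambda>p. multiplicity p d) P \<in> B"
      using d assms(1) by (auto simp: B_def intro!: dvd_imp_multiplicity_le)
  qed
  finally show ?thesis unfolding P_def ..
qed

text \<open>The recursion behind the Dirichlet series of powers of zeta. Prime by prime it is the
  hockey-stick identity for binomial coefficients.\<close>

lemma dk_sum_divisors:
  assumes "n > 0"
  shows "(\<Sum>d | d dvd n. dk (real (Suc j)) d) = dk (real (Suc (Suc j))) n"
proof -
  have "(\<Sum>d | d dvd n. dk (real (Suc j)) d) =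
      (\<Prod>p\<in>prime_factors n. \<Sum>a\<le>multiplicity p n. real ((j + a) choose a))"
    unfolding dk_Suc
    using assms by (intro sum_divisors_prod_prime_factors[where h = "\<lambda>_ a. real ((j + a) choose a)"]) auto
  also have "\<dots> = dk (real (Suc (Suc j))) n"
    unfolding dk_Suc[of "Suc j"] of_nat_sum[symmetric] sum_choose_lower by simp
  finally show ?thesis .
qed

lemma dk_1: "dk 1 n = 1"
  using dk_Suc[of 0 n] by simp

lemma dk_nonneg: "dk (real k) n \<ge> 0" if "k \<ge> 1"
  using that dk_Suc[of "k - 1" n] by (auto intro: prod_nonneg)

lemma dk_Suc_0: "dk (real k) (Suc 0) = 1"
  by (simp add: dk_def)

text \<open>A finite Euler product bound: n <= N is determined by its exponents at the primes up to
  N, and these are at most N because \<open>2 ^ a <= n\<close>. Expanding the product yields all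
  these terms and further nonnegative ones.\<close>

lemma sum_prod_prime_factors_le:
  fixes h :: "nat \<Rightarrow> nat \<Rightarrow> real"
  assumes "\<And>p. h p 0 = 1" "\<And>p a. h p a \<ge> 0"
  shows "(\<Sum>n=1..N. \<Prod>p\<in>prime_factors n. h p (multiplicity p n))
           \<le> (\<Prod>p | prime p \<and> p \<le> N. \<Sum>a\<le>N. h p a)"
proof -
  define P where "P = {p. prime p \<and> p \<le> N}"
  have P: "finite P" "\<And>p. p \<in> P \<Longrightarrow> prime p" by (auto simp: P_def)
  define g where "g = (\<lambda>n. restrict (\<lambda>p. multiplicity p n) P)"
  have sub: "prime_factors n \<subseteq> P" if "n \<in> {1..N}" for n
    using that by (auto simp: P_def prime_factors_dvd dest: dvd_imp_le)
  have "(\<Sum>n=1..N. \<Prod>p\<in>prime_factors n. h p (multiplicity p n)) =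
        (\<Sum>n=1..N. \<Prod>p\<in>P. h p (g n p))"
  proof (rule sum.cong)
    fix n assume n: "n \<in> {1..N}"
    have "(\<Prod>p\<in>prime_factors n. h p (multiplicity p n)) = (\<Prod>p\<in>P. h p (multiplicity p n))"
      using sub[OF n] P assms by (intro prod_prime_factors_extend) auto
    then show "(\<Prod>p\<in>prime_factors n. h p (multiplicity p n)) = (\<Prod>p\<in>P. h p (g n p))"
      by (simp add: g_def)
  qed simp
  also have "\<dots> = (\<Sum>e\<in>g ` {1..N}. \<Prod>p\<in>P. h p (e p))"
  proof (rule sum.reindex[symmetric, unfolded o_def])
    show "inj_on g {1..N}"
    proof (rule inj_onI)
      fix x y assume x: "x \<in> {1..N}" and y: "y \<in> {1..N}" and eq: "g x = g y"
      show "x = y"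
      proof (rule multiplicity_eq_nat)
        fix p :: nat assume p: "prime p"
        show "multiplicity p x = multiplicity p y"
        proof (cases "p \<in> P")
          case True
          then show ?thesis using fun_cong[OF eq, of p] by (simp add: g_def)
        next
          case False
          then have "p \<notin> prime_factors x" "p \<notin> prime_factors y" using sub x y by auto
          then show ?thesis using p by (metis count_prime_factorization_prime not_in_iff)
        qed
      qed (use x y in auto)
    qed
  qed
  also have "\<dots> \<le> (\<Sum>e\<in>PiE P (\<lambda>_. {..N}). \<Prod>p\<in>P. h p (e p))"
  proof (rule sum_mono2)
    show "g ` {1..N} \<subseteq> PiE P (\<lambda>_. {..N})"
    proof (rule image_subsetI)
      fix n assume n: "n \<in> {1..N}"
      have "multiplicity p n \<le> N" if "p \<in> P" for p
      proof -
        have "multiplicity p n \<le> 2 ^ multiplicity p n" by (simp add: less_imp_le)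
        also have "\<dots> \<le> p ^ multiplicity p n" using P(2)[OF that] by (intro power_mono) (auto dest: prime_ge_2_nat)
        also have "\<dots> \<le> n" using n by (intro dvd_imp_le multiplicity_dvd) auto
        finally show ?thesis using n by simp
      qed
      then have "g n \<in> PiE P (\<lambda>_. {..N})" by (auto simp: g_def)
      then show "g n \<in> P \<rightarrow>\<^sub>E {..N}" .
    qed
    show "finite (PiE P (\<lambda>_. {..N}))" using P by (intro finite_PiE) auto
  qed (use assms in \<open>auto intro: prod_nonneg\<close>)
  also have "\<dots> = (\<Prod>p\<in>P. \<Sum>a\<le>N. h p a)"
    using P by (intro prod_sum_PiE[symmetric]) auto
  finally show ?thesis unfolding P_def .
qed

text \<open>A truncation of \<open>(1 - x) * (1 - x)^(-(j+2)) = (1 - x)^(-(j+1))\<close>. The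
  boundary term is nonnegative for x >= 0, so dropping it gives the induction step of
  \<open>sum_choose_power_le\<close> without any infinite series.\<close>

lemma one_minus_mult_sum_choose:
  fixes x :: real
  shows "(1 - x) * (\<Sum>a\<le>N. real ((Suc j + a) choose a) * x ^ a)
           + real ((Suc j + N) choose N) * x ^ Suc N
         = (\<Sum>a\<le>N. real ((j + a) choose a) * x ^ a)"
proof (induction N)
  case 0
  then show ?case by simp
next
  case (Suc N)
  have pascal: "real ((Suc j + Suc N) choose Suc N) =
                  real ((Suc j + N) choose N) + real ((j + Suc N) choose Suc N)"
    by simp
  show ?case
    unfolding sum.atMost_Suc distrib_left Suc.IH[symmetric] pascal
    by (simp add: algebra_simps del: binomial_Suc_Suc)
qed

lemma sum_choose_power_le:
  fixes x :: real
  assumes "0 \<le> x" "x < 1"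
  shows "(\<Sum>a\<le>N. real ((j + a) choose a) * x ^ a) \<le> (1 / (1 - x)) ^ Suc j"
proof (induction j)
  case 0
  have "(1 - x) * (\<Sum>a\<le>N. x ^ a) = 1 - x ^ Suc N"
    by (rule sum_gp_basic)
  also have "\<dots> \<le> 1" using assms by simp
  finally show ?case using assms by (simp add: field_simps)
next
  case (Suc j)
  have "(1 - x) * (\<Sum>a\<le>N. real ((Suc j + a) choose a) * x ^ a)
          \<le> (\<Sum>a\<le>N. real ((j + a) choose a) * x ^ a)"
    unfolding one_minus_mult_sum_choose[where x = x and N = N and j = j, symmetric] using assms by simp
  also note Suc.IH
  finally have "(1 / (1 - x)) * ((1 - x) * (\<Sum>a\<le>N. real ((Suc j + a) choose a) * x ^ a))
          \<le> (1 / (1 - x)) * (1 / (1 - x)) ^ Suc j"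
    using assms by (intro mult_left_mono) auto
  then show ?case using assms by simp
qed

text \<open>The coefficient is the product of (j + i)/i over i = 1, ..., a, and each factor is at
  most j + 1.\<close>

lemma choose_le_power: "real ((j + a) choose a) \<le> real (Suc j) ^ a"
proof (induction a)
  case 0
  then show ?case by simp
next
  case (Suc a)
  have "real ((j + Suc a) choose Suc a) * real (Suc a) = real (Suc (j + a)) * real ((j + a) choose a)"
    using Suc_times_binomial_eq[of "j + a" a] by (metis add_Suc_right of_nat_mult)
  also have "\<dots> \<le> (real (Suc j) * real (Suc a)) * real (Suc j) ^ a"
    by (intro mult_mono Suc.IH) (auto simp: algebra_simps)
  finally show ?case by (simp add: mult_ac del: of_nat_Suc)
qed

section \<open>Local factors of the Euler product\<close>

lemma inverse_one_minus_le_exp: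
  fixes x :: real
  assumes "0 \<le> x" "x \<le> 1 - 1 / C" "C > 0"
  shows "1 / (1 - x) \<le> exp (C * x)"
proof -
  have lt: "1 - x \<ge> 1 / C" "1 / C > 0" using assms by simp_all
  have "1 / (1 - x) \<le> 1 / (1 / C)" using lt less_le_trans[OF lt(2,1)] assms(3) by (intro divide_left_mono) auto
  then have "1 / (1 - x) \<le> C" by simp
  then have "x * (1 / (1 - x)) \<le> x * C" using assms by (intro mult_left_mono)
  moreover have "1 / (1 - x) = 1 + x * (1 / (1 - x))"
    using less_le_trans[OF lt(2,1)] by (simp add: divide_simps)
  ultimately have "1 / (1 - x) \<le> 1 + C * x" by (simp add: mult.commute)
  also have "\<dots> \<le> exp (C * x)" by (rule exp_ge_add_one_self)
  finally show ?thesis .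
qed

text \<open>A sum of squares of nonnegative terms is at most the square of the sum, here at most
  \<open>(1 - x)^(-2k)\<close> with k = j + 1. The exponent is linear in k x, which is preferable
  when k x is large. The limit 3/4 admits x = \<open>p powr (-s)\<close> for every prime p when s >
  1/2, as 1/sqrt 2 < 3/4.\<close>

lemma local_factor_le_small:
  fixes x :: real
  assumes "0 \<le> x" "x \<le> 3/4"
  shows "(\<Sum>a\<le>N. (real ((j + a) choose a) * x ^ a)\<^sup>2) \<le> exp (8 * real (Suc j) * x)"
proof -
  define u where "u = (\<lambda>a. real ((j + a) choose a) * x ^ a)"
  have u: "u a \<ge> 0" for a using assms by (simp add: u_def)
  have "(\<Sum>a\<le>N. (u a)\<^sup>2) \<le> (\<Sum>a\<le>N. u a * (\<Sum>a\<le>N. u a))"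
    unfolding power2_eq_square using u by (intro sum_mono mult_left_mono member_le_sum) auto
  also have "\<dots> = (\<Sum>a\<le>N. u a)\<^sup>2" by (simp add: sum_distrib_right power2_eq_square)
  also have "\<dots> \<le> ((1 / (1 - x)) ^ Suc j)\<^sup>2"
    using u assms unfolding u_def by (intro power_mono sum_choose_power_le sum_nonneg) auto
  also have "\<dots> \<le> (exp (4 * x) ^ Suc j)\<^sup>2"
    using assms inverse_one_minus_le_exp[of x 4] by (intro power_mono) auto
  also have "\<dots> = exp (8 * real (Suc j) * x)"
    by (simp add: exp_of_nat_mult[symmetric] exp_double[symmetric] power_mult[symmetric] algebra_simps
             flip: exp_of_nat_mult exp_add)
  finally show ?thesis unfolding u_def .
qed

text \<open>By \<open>choose_le_power\<close> the terms are at most powers of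
  \<open>q = (k x)^2\<close>, with k = j + 1 and q at most 1/4, so a geometric series bounds the
  sum. The gain from linear to quadratic in x makes the sum over all large primes converge, as 2 s >
  1.\<close>

lemma local_factor_le_large:
  fixes x :: real
  assumes "0 \<le> x" "real (Suc j) * x \<le> 1/2"
  shows "(\<Sum>a\<le>N. (real ((j + a) choose a) * x ^ a)\<^sup>2) \<le> exp (2 * (real (Suc j))\<^sup>2 * x\<^sup>2)"
proof -
  define q where "q = (real (Suc j) * x)\<^sup>2"
  have "q \<le> (1/2)\<^sup>2" unfolding q_def using assms by (intro power_mono) auto
  then have q: "0 \<le> q" "q \<le> 1/2" by (auto simp: q_def power2_eq_square)
  have "(\<Sum>a\<le>N. (real ((j + a) choose a) * x ^ a)\<^sup>2) \<le> (\<Sum>a\<le>N. q ^ a)"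
  proof (rule sum_mono)
    fix a
    have "(real ((j + a) choose a) * x ^ a)\<^sup>2 \<le> (real (Suc j) ^ a * x ^ a)\<^sup>2"
      using assms choose_le_power[of j a] by (intro power_mono mult_right_mono) auto
    also have "\<dots> = q ^ a" unfolding q_def
      by (simp add: power_mult_distrib power_mult[symmetric] mult.commute del: of_nat_Suc)
    finally show "(real ((j + a) choose a) * x ^ a)\<^sup>2 \<le> q ^ a" .
  qed
  also have "\<dots> \<le> 1 / (1 - q)" using sum_choose_power_le[where x = q and N = N and j = 0] q by simp
  also have "\<dots> \<le> exp (2 * q)" using q by (intro inverse_one_minus_le_exp) auto
  finally show ?thesis by (simp add: q_def power_mult_distrib mult.assoc)
qed

text \<open>Comparison with the integral of \<open>x powr (e - 1)\<close> for both signs of e: e = 1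
  - s handles the small primes from m = 0 on, and e = 1 - 2 s the tail, which has to start at m >=
  1.\<close>

lemma powr_telescope:
  fixes e :: real
  assumes "e < 1" "e \<noteq> 0" "m \<ge> 1 \<or> e > 0"
  shows "real (Suc m) powr (e - 1) \<le> real (Suc m) powr e / e - real m powr e / e"
proof -
  have "\<exists>z\<in>{real m<..<real (Suc m)}. real (Suc m) powr e / e - real m powr e / e =
            (\<lambda>h. z powr (e - 1) * h) (real (Suc m) - real m)"
  proof (rule mvt)
    show "continuous_on {real m..real (Suc m)} (\<lambda>x. x powr e / e)"
      using assms by (intro continuous_intros continuous_on_powr') auto
    fix x assume "real m < x" "x < real (Suc m)"
    then have "((\<lambda>x. x powr e / e) has_real_derivative e * x powr (e - 1) / e) (at x)"
      using assms by (intro DERIV_cdivide has_real_derivative_powr) auto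
    then show "((\<lambda>x. x powr e / e) has_derivative (\<lambda>h. x powr (e - 1) * h)) (at x)"
      using assms by (simp add: has_field_derivative_def)
  qed auto
  then obtain z where z: "real m < z" "z < real (Suc m)"
      "real (Suc m) powr e / e - real m powr e / e = z powr (e - 1)" by auto
  have "real (Suc m) powr (e - 1) \<le> z powr (e - 1)"
    using z assms by (intro powr_mono2') auto
  then show ?thesis using z by simp
qed

lemma sum_powr_le:
  fixes e :: real
  assumes "e < 1" "e \<noteq> 0" "m \<ge> 1 \<or> e > 0" "m \<le> N"
  shows "(\<Sum>n\<in>{m<..N}. real n powr (e - 1)) \<le> real N powr e / e - real m powr e / e"
  using assms(4)
proof (induction N rule: dec_induct)
  case base
  then show ?case by simp
next
  case (step n)
  have "{m<..Suc n} = insert (Suc n) {m<..n}" using step by auto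
  then have "(\<Sum>n\<in>{m<..Suc n}. real n powr (e - 1))
      = real (Suc n) powr (e - 1) + (\<Sum>n\<in>{m<..n}. real n powr (e - 1))" by simp
  also have "\<dots> \<le> (real (Suc n) powr e / e - real n powr e / e) + (real n powr e / e - real m powr e / e)"
    using assms step by (intro add_mono step.IH powr_telescope) auto
  finally show ?case by simp
qed

text \<open>The exponent 1/s comes from splitting the primes at y of order
  \<open>k powr (1/s)\<close>, where \<open>k * p powr (-s)\<close> is about 1. The local exponents
  add up to at most the order of \<open>k * y powr (1 - s)\<close> below y and of
  \<open>k^2 * y powr (1 - 2 * s)\<close> above, and both are of order y. The dependence on s is
  explicit because the bound is later applied at the moving point \<sigma> - \<alpha>.\<close>

lemma diag_partial_sum_le:
  fixes s :: real
  assumes s: "1/2 < s" "s < 1" and k: "k \<ge> 1"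
  shows "(\<Sum>n=1..N. (dk (real k) n)\<^sup>2 / real n powr (2 * s))
           \<le> exp ((16 / (1 - s) + 4 / (2 * s - 1)) * real k powr (1 / s))"
proof -
  obtain j where j: "k = Suc j" using k by (cases k) auto
  \<comment> \<open>For \<open>p \<le> y\<close> the local factor is bounded by the square of the factor of \<open>\<zeta>(s)\<^sup>k\<close>;
     for \<open>p > y\<close> one has \<open>k p\<^bsup>-s\<^esup> < 1/2\<close> and a geometric series suffices.\<close>
  define y where "y = (2 * real k) powr (1 / s)"
  have ys: "y powr s = 2 * real k" using s k by (simp add: y_def powr_powr)
  have y1: "y \<ge> 1" unfolding y_def using s k by (intro ge_one_powr_ge_zero) auto
  define m where "m = nat \<lfloor>y\<rfloor>"
  have m1: "m \<ge> 1" using y1 by (simp add: m_def le_nat_iff)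
  have my: "real m \<le> y" "y / 2 \<le> real m" using y1 m1 by (simp_all add: m_def) linarith+
  have mlt: "real n > y" if "n > m" for n using that y1 by (simp add: m_def) linarith
  define h where "h = (\<lambda>(p::nat) a. (real ((j + a) choose a) * (real p powr (- s)) ^ a)\<^sup>2)"
  define E where "E = (\<lambda>n. if n \<le> m then 8 * real k * real n powr (- s) else 2 * (real k)\<^sup>2 * (real n powr (- s))\<^sup>2)"
  have E0: "E n \<ge> 0" for n by (simp add: E_def)
  have "(\<Sum>n=1..N. (dk (real k) n)\<^sup>2 / real n powr (2 * s)) =
        (\<Sum>n=1..N. \<Prod>p\<in>prime_factors n. h p (multiplicity p n))"
  proof (rule sum.cong)
    fix n assume n: "n \<in> {1..N}"
    have "real n powr (- s) = (\<Prod>p\<in>prime_factors n. (real p powr (- s)) ^ multiplicity p n)"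
    proof -
      have "real n = (\<Prod>p\<in>prime_factors n. real p ^ multiplicity p n)"
        using prime_factorization_nat[of n] n by (metis (no_types, lifting) atLeastAtMost_iff of_nat_power of_nat_prod prod.cong less_le_trans zero_less_one)
      then have "real n powr (- s) = (\<Prod>p\<in>prime_factors n. real p ^ multiplicity p n) powr (- s)" by simp
      also have "\<dots> = (\<Prod>p\<in>prime_factors n. (real p ^ multiplicity p n) powr (- s))"
        by (rule prod_powr_distrib)
      also have "\<dots> = (\<Prod>p\<in>prime_factors n. (real p powr (- s)) ^ multiplicity p n)"
      proof (rule prod.cong)
        fix p assume "p \<in> prime_factors n"
        then have "real p > 0" using prime_gt_0_nat by auto
        then show "(real p ^ multiplicity p n) powr (- s) = (real p powr (- s)) ^ multiplicity p n"
          by (simp add: powr_realpow[symmetric] powr_powr mult.commute)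
      qed simp
      finally show ?thesis .
    qed
    then have "(\<Prod>p\<in>prime_factors n. h p (multiplicity p n)) = (dk (real k) n * real n powr (- s))\<^sup>2"
      unfolding h_def j dk_Suc prod_power_distrib[symmetric] prod.distrib by simp
    also have "\<dots> = (dk (real k) n)\<^sup>2 / real n powr (2 * s)"
      using n by (simp add: power_mult_distrib powr_minus_divide power_divide powr_power)
    finally show "(dk (real k) n)\<^sup>2 / real n powr (2 * s) = (\<Prod>p\<in>prime_factors n. h p (multiplicity p n))" ..
  qed simp
  also have "\<dots> \<le> (\<Prod>p | prime p \<and> p \<le> N. \<Sum>a\<le>N. h p a)"
    by (rule sum_prod_prime_factors_le) (auto simp: h_def)
  also have "\<dots> \<le> (\<Prod>p | prime p \<and> p \<le> N. exp (E p))"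
  proof (rule prod_mono, safe)
    fix p :: nat assume p: "prime p"
    have p2: "p \<ge> 2" using p by (rule prime_ge_2_nat)
    show "0 \<le> (\<Sum>a\<le>N. h p a)" by (auto simp: h_def intro: sum_nonneg)
    show "(\<Sum>a\<le>N. h p a) \<le> exp (E p)"
    proof (cases "p \<le> m")
      case True
      have "real p powr (- s) \<le> 2 powr (- s)" using p2 s by (intro powr_mono2') auto
      also have "\<dots> \<le> 2 powr (- (1/2))" using s by (intro powr_mono) auto
      also have "\<dots> \<le> 3/4"
      proof -
        have "4 / 3 \<le> sqrt (2::real)" by (rule real_le_rsqrt) (simp add: power2_eq_square)
        then show ?thesis by (simp add: powr_minus powr_half_sqrt field_simps)
      qed
      finally have "(\<Sum>a\<le>N. h p a) \<le> exp (8 * real (Suc j) * real p powr (- s))"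
        unfolding h_def by (intro local_factor_le_small) auto
      then show ?thesis using True by (simp add: E_def j)
    next
      case False
      then have "real p > y" using mlt by simp
      then have "2 * real k \<le> real p powr s"
        unfolding ys[symmetric] using y1 s by (intro powr_mono2) auto
      then have "real (Suc j) * real p powr (- s) \<le> 1/2"
        using p2 by (simp add: powr_minus j field_simps)
      then have "(\<Sum>a\<le>N. h p a) \<le> exp (2 * (real (Suc j))\<^sup>2 * (real p powr (- s))\<^sup>2)"
        unfolding h_def by (intro local_factor_le_large) auto
      then show ?thesis using False by (simp add: E_def j)
    qed
  qed
  also have "\<dots> = exp (\<Sum>p | prime p \<and> p \<le> N. E p)"
    by (rule exp_sum[symmetric]) auto
  \<comment> \<open>Primes are replaced by all integers, which only forgoes a logarithmic saving.
    The upper end is \<open>max m N\<close> because N may be below m.\<close>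
  also have "\<dots> \<le> exp (\<Sum>n\<in>{0<..m} \<union> {m<..max m N}. E n)"
    using E0 by (subst exp_le_cancel_iff, intro sum_mono2) (auto dest: prime_gt_0_nat)
  also have "(\<Sum>n\<in>{0<..m} \<union> {m<..max m N}. E n) = (\<Sum>n\<in>{0<..m}. E n) + (\<Sum>n\<in>{m<..max m N}. E n)"
    by (rule sum.union_disjoint) auto
  also have "(\<Sum>n\<in>{0<..m}. E n) = 8 * real k * (\<Sum>n\<in>{0<..m}. real n powr ((1 - s) - 1))"
    by (simp add: E_def sum_distrib_left)
  also have "(\<Sum>n\<in>{m<..max m N}. E n) = 2 * (real k)\<^sup>2 * (\<Sum>n\<in>{m<..max m N}. real n powr ((1 - 2 * s) - 1))"
    by (auto simp: E_def sum_distrib_left powr_power mult.commute intro!: sum.cong)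
  also have "exp (8 * real k * (\<Sum>n\<in>{0<..m}. real n powr ((1 - s) - 1)) +
                  2 * (real k)\<^sup>2 * (\<Sum>n\<in>{m<..max m N}. real n powr ((1 - 2 * s) - 1)))
             \<le> exp (8 * real k * (y powr (1 - s) / (1 - s)) + 2 * (real k)\<^sup>2 * (2 * y powr (1 - 2 * s) / (2 * s - 1)))"
  proof (subst exp_le_cancel_iff, intro add_mono mult_left_mono)
    have "(\<Sum>n\<in>{0<..m}. real n powr ((1 - s) - 1)) \<le> real m powr (1 - s) / (1 - s) - real 0 powr (1 - s) / (1 - s)"
      using s by (intro sum_powr_le) auto
    also have "\<dots> \<le> y powr (1 - s) / (1 - s)"
      using s my by (auto intro!: divide_right_mono powr_mono2)
    finally show "(\<Sum>n\<in>{0<..m}. real n powr ((1 - s) - 1)) \<le> y powr (1 - s) / (1 - s)" .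
    have "(\<Sum>n\<in>{m<..max m N}. real n powr ((1 - 2 * s) - 1)) \<le>
            real (max m N) powr (1 - 2 * s) / (1 - 2 * s) - real m powr (1 - 2 * s) / (1 - 2 * s)"
      using s m1 by (intro sum_powr_le) auto
    also have "\<dots> \<le> real m powr (1 - 2 * s) / (2 * s - 1)"
    proof -
      have "real (max m N) powr (1 - 2 * s) / (1 - 2 * s) \<le> 0" using s by (intro divide_nonneg_nonpos) auto
      moreover have "- (real m powr (1 - 2 * s) / (1 - 2 * s)) = real m powr (1 - 2 * s) / (2 * s - 1)"
        by (metis minus_diff_eq minus_divide_right)
      ultimately show ?thesis by linarith
    qed
    also have "\<dots> \<le> 2 * y powr (1 - 2 * s) / (2 * s - 1)"
    proof (rule divide_right_mono)
      \<comment> \<open>The exponent is negative and m may be as small as y/2; this costs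
        \<open>2 powr (2 * s - 1)\<close>, at most 2.\<close>
      have "real m powr (1 - 2 * s) \<le> (y / 2) powr (1 - 2 * s)"
        using my y1 s by (intro powr_mono2') auto
      also have "\<dots> = y powr (1 - 2 * s) * 2 powr (2 * s - 1)"
        using y1 powr_minus_divide[of 2 "2 * s - 1"] by (simp add: powr_divide)
      also have "\<dots> \<le> y powr (1 - 2 * s) * 2 powr 1"
        using s by (intro mult_left_mono powr_mono) auto
      finally show "real m powr (1 - 2 * s) \<le> 2 * y powr (1 - 2 * s)" by simp
    qed (use s in auto)
    finally show "(\<Sum>n\<in>{m<..max m N}. real n powr ((1 - 2 * s) - 1)) \<le> 2 * y powr (1 - 2 * s) / (2 * s - 1)" .
  qed auto
  also have "8 * real k * (y powr (1 - s) / (1 - s)) + 2 * (real k)\<^sup>2 * (2 * y powr (1 - 2 * s) / (2 * s - 1))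
             = (4 / (1 - s) + 1 / (2 * s - 1)) * y"
  proof -
    have ky: "real k = y powr s / 2" using ys by simp
    have a: "y powr s * y powr (1 - s) = y" using y1 by (simp add: powr_add[symmetric])
    have b: "(y powr s)\<^sup>2 * y powr (1 - 2 * s) = y" using y1 by (simp add: powr_power powr_add[symmetric])
    have "8 * real k * (y powr (1 - s) / (1 - s)) = 4 * (y powr s * y powr (1 - s)) / (1 - s)"
      unfolding ky by simp
    moreover have "2 * (real k)\<^sup>2 * (2 * y powr (1 - 2 * s) / (2 * s - 1)) =
        ((y powr s)\<^sup>2 * y powr (1 - 2 * s)) / (2 * s - 1)"
      unfolding ky by (simp add: power_divide)
    ultimately have "8 * real k * (y powr (1 - s) / (1 - s)) + 2 * (real k)\<^sup>2 * (2 * y powr (1 - 2 * s) / (2 * s - 1))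
        = 4 * y / (1 - s) + y / (2 * s - 1)" by (simp only: a b)
    also have "\<dots> = (4 / (1 - s) + 1 / (2 * s - 1)) * y" by (simp add: distrib_right)
    finally show ?thesis .
  qed
  also have "exp ((4 / (1 - s) + 1 / (2 * s - 1)) * y) \<le> exp ((4 / (1 - s) + 1 / (2 * s - 1)) * (4 * real k powr (1 / s)))"
  proof (subst exp_le_cancel_iff, rule mult_left_mono)
    \<comment> \<open>Since 1/s < 2, the factor 2 inside y contributes at most 4, whence the
      constants 16 and 4.\<close>
    have "y = 2 powr (1 / s) * real k powr (1 / s)" unfolding y_def by (rule powr_mult)
    also have "\<dots> \<le> 2 powr 2 * real k powr (1 / s)"
      using s by (intro mult_right_mono powr_mono) (auto simp: field_simps)
    finally show "y \<le> 4 * real k powr (1 / s)" by simp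
  qed (use s in auto)
  also have "(4 / (1 - s) + 1 / (2 * s - 1)) * (4 * real k powr (1 / s)) =
             (16 / (1 - s) + 4 / (2 * s - 1)) * real k powr (1 / s)"
    by (simp add: algebra_simps)
  finally show ?thesis .
qed

text \<open>Bounded partial sums of nonnegative terms converge. The lower bound is the term n = 1;
  it is what later turns absolute errors into relative ones.\<close>

lemma
  fixes s :: real
  assumes s: "1/2 < s" "s < 1" and k: "k \<ge> 1"
  shows diag_summable: "summable (\<lambda>n. (dk (real k) (Suc n))\<^sup>2 / real (Suc n) powr (2 * s))"
    and diag_sum_le: "diag_sum s k \<le> exp ((16 / (1 - s) + 4 / (2 * s - 1)) * real k powr (1 / s))"
    and diag_sum_ge_1: "diag_sum s k \<ge> 1"
proof -
  define f where "f = (\<lambda>n. (dk (real k) (Suc n))\<^sup>2 / real (Suc n) powr (2 * s))"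
  have f0: "f n \<ge> 0" for n by (simp add: f_def)
  have part: "(\<Sum>i<n. f i) \<le> exp ((16 / (1 - s) + 4 / (2 * s - 1)) * real k powr (1 / s))" for n
    using diag_partial_sum_le[OF assms, of n]
      sum.shift_bounds_Suc_ivl[of "\<lambda>n. (dk (real k) n)\<^sup>2 / real n powr (2 * s)" 0 n]
    by (simp add: f_def atLeast0LessThan atLeastLessThanSuc_atLeastAtMost)
  show sm: "summable f"
    using f0 part by (intro summableI_nonneg_bounded) auto
  show "diag_sum s k \<le> exp ((16 / (1 - s) + 4 / (2 * s - 1)) * real k powr (1 / s))"
    unfolding diag_sum_def f_def[symmetric] using suminf_le_const[OF sm part] by (simp add: f_def)
  have "(\<Sum>i<1. f i) \<le> suminf f" using sm f0 by (intro sum_le_suminf) auto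
  then show "diag_sum s k \<ge> 1" unfolding diag_sum_def f_def[symmetric] by (simp add: f_def dk_Suc_0)
qed

section \<open>Powers of zeta as Dirichlet series\<close>

lemma zeta_has_sum:
  assumes "Re s > 1"
  shows "((\<lambda>n. of_nat n powr (-s)) has_sum zeta s) {0<..}"
proof -
  have "summable (\<lambda>n. real n powr (- Re s))" using assms by (simp add: summable_real_powr_iff)
  then have "summable (\<lambda>n. real (Suc n) powr (- Re s))" by (subst summable_Suc_iff)
  then have "summable (\<lambda>n. norm (of_nat (Suc n) powr (-s)))"
    by (simp add: norm_powr_real_powr del: of_nat_Suc)
  then have "((\<lambda>n. of_nat (Suc n) powr (-s)) has_sum zeta s) UNIV"
    using zeta_sums[OF assms] by (rule norm_summable_imp_has_sum)
  moreover have "bij_betw Suc UNIV {0<..}"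
    by (rule bij_betwI[of _ _ _ "\<lambda>n. n - 1"]) auto
  ultimately show ?thesis
    using has_sum_reindex_bij_betw[of Suc UNIV "{0<..}" "\<lambda>n. of_nat n powr (-s)" "zeta s"] by blast
qed

text \<open>Unordered summation makes the Dirichlet product a mere regrouping of the double sum over
  pairs (d, e) by their product n = d e; \<open>dk_sum_divisors\<close> then evaluates the inner
  sums.\<close>

lemma zeta_power_has_sum:
  assumes "Re s > 1"
  shows "((\<lambda>n. of_real (dk (real (Suc j)) n) * of_nat n powr (-s)) has_sum zeta s ^ Suc j) {0<..}"
proof (induction j)
  case 0
  show ?case using zeta_has_sum[OF assms] by (simp add: dk_1)
next
  case (Suc j)
  define A where "A = {0::nat<..}"
  define f where "f = (\<lambda>n. complex_of_real (dk (real (Suc j)) n) * of_nat n powr (-s))"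
  define g where "g = (\<lambda>n. complex_of_nat n powr (-s))"
  have f: "(f has_sum zeta s ^ Suc j) A" using Suc.IH by (simp add: f_def A_def)
  have g: "(g has_sum zeta s) A" using zeta_has_sum[OF assms] by (simp add: g_def A_def)
  have fg: "((\<lambda>(x, y). f x * g y) has_sum zeta s ^ Suc (Suc j)) (A \<times> A)"
  proof (rule has_sum_SigmaI)
    show "((\<lambda>y. case (x, y) of (x, y) \<Rightarrow> f x * g y) has_sum f x * zeta s) A" if "x \<in> A" for x
      using has_sum_cmult_right[OF g, of "f x"] by simp
    show "((\<lambda>x. f x * zeta s) has_sum zeta s ^ Suc (Suc j)) A"
      using has_sum_cmult_left[OF f, of "zeta s"] by (simp add: mult_ac)
    have nf: "(\<lambda>x. norm (f x)) summable_on A" and ng: "(\<lambda>x. norm (g x)) summable_on A"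
      using f g summable_on_iff_abs_summable_on_complex has_sum_imp_summable by blast+
    \<comment> \<open>Absolute summability over all pairs is what licenses the regrouping.\<close>
    have "(\<lambda>p. norm (case p of (x, y) \<Rightarrow> f x * g y)) summable_on A \<times> A"
    proof (rule summable_on_SigmaI)
      show "((\<lambda>y. norm (case (x, y) of (x, y) \<Rightarrow> f x * g y)) has_sum
               norm (f x) * infsum (\<lambda>y. norm (g y)) A) A" if "x \<in> A" for x
        using has_sum_cmult_right[OF has_sum_infsum[OF ng], of "norm (f x)"] by (simp add: norm_mult)
      show "(\<lambda>x. norm (f x) * infsum (\<lambda>y. norm (g y)) A) summable_on A"
        using nf by (rule summable_on_cmult_left)
    qed auto
    then show "(\<lambda>(x, y). f x * g y) summable_on A \<times> A"
      by (rule abs_summable_summable)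
  qed
  \<comment> \<open>The pair (d, e) is recorded as (d e, d), so that the fibre over n consists of
    the divisors of n.\<close>
  have fg': "((\<lambda>(n, d). f d * g (n div d)) has_sum zeta s ^ Suc (Suc j)) (Sigma A (\<lambda>n. {d. d dvd n}))"
    by (rule has_sum_reindex_bij_witness[THEN iffD1, OF _ _ _ _ _ _ fg, of "\<lambda>(n, d). (d, n div d)" "\<lambda>(d, e). (d * e, d)"])
       (auto simp: A_def dest: dvd_imp_le)
  show ?case
    unfolding A_def[symmetric]
  proof (rule has_sum_SigmaD[OF fg'])
    fix n assume n: "n \<in> A"
    have fin: "finite {d. d dvd n}" using n by (auto simp: A_def)
    have "((\<lambda>d. f d * g (n div d)) has_sum (\<Sum>d | d dvd n. f d * g (n div d))) {d. d dvd n}"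
      using fin by (rule has_sum_finite)
    also have "(\<Sum>d | d dvd n. f d * g (n div d)) =
               (\<Sum>d | d dvd n. of_real (dk (real (Suc j)) d) * of_nat n powr (-s))"
    proof (rule sum.cong)
      fix d assume "d \<in> {d. d dvd n}"
      then obtain e where e: "n = d * e" by auto
      then have d: "d > 0" "e > 0" using n by (auto simp: A_def)
      have "complex_of_nat n powr (-s) = of_nat d powr (-s) * of_nat e powr (-s)"
        unfolding e of_nat_mult by (rule powr_times_real) auto
      then show "f d * g (n div d) = of_real (dk (real (Suc j)) d) * of_nat n powr (-s)"
        using d by (simp add: e f_def g_def)
    qed simp
    also have "\<dots> = of_real (dk (real (Suc (Suc j))) n) * of_nat n powr (-s)"
      using n by (simp only: dk_sum_divisors[symmetric] A_def greaterThan_iff of_real_sum sum_distrib_right)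
    finally show "((\<lambda>d. case (n, d) of (n, d) \<Rightarrow> f d * g (n div d)) has_sum
       of_real (dk (real (Suc (Suc j))) n) * of_nat n powr (-s)) {d. d dvd n}" by simp
  qed
qed

lemma zeta_power_sums:
  assumes "Re s > 1" "k \<ge> 1"
  shows "(\<lambda>n. of_real (dk (real k) (Suc n)) * of_nat (Suc n) powr (-s)) sums zeta s ^ k"
proof -
  have "bij_betw Suc UNIV {0<..}"
    by (rule bij_betwI[of _ _ _ "\<lambda>n. n - 1"]) auto
  then have "((\<lambda>n. of_real (dk (real k) (Suc n)) * of_nat (Suc n) powr (-s)) has_sum zeta s ^ k) UNIV"
    using zeta_power_has_sum[of s "k - 1"] assms
      has_sum_reindex_bij_betw[of Suc UNIV "{0<..}" "\<lambda>n. of_real (dk (real k) n) * of_nat n powr (-s)" "zeta s ^ k"] by simp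
  then show ?thesis by (rule has_sum_imp_sums)
qed

text \<open>The value at 2 dominates the series of \<open>zeta s ^ k\<close> for Re s >= 2. The base
  3 is \<open>norm_zeta_le\<close> at 2; it is crude but harmless, since k will be O(log T / log log
  T) and \<open>3 ^ k\<close> then stays below any positive power of T.\<close>

lemma dk_series_at_2:
  assumes "k \<ge> 1"
  shows "(\<lambda>n. dk (real k) (Suc n) * real (Suc n) powr (-2)) sums Re (zeta 2 ^ k)"
    and "Re (zeta 2 ^ k) \<le> 3 ^ k"
proof -
  have "(\<lambda>n. Re (of_real (dk (real k) (Suc n)) * of_nat (Suc n) powr (-2))) sums Re (zeta 2 ^ k)"
    using assms by (intro sums_Re zeta_power_sums) auto
  moreover have "Re (of_real (dk (real k) (Suc n)) * of_nat (Suc n) powr (-2)) = dk (real k) (Suc n) * real (Suc n) powr (-2)" for n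
  proof -
    have "complex_of_nat (Suc n) powr (-2) = of_real (real (Suc n) powr (-2))"
      using powr_of_real[of "real (Suc n)" "-2"] by simp
    then show ?thesis by simp
  qed
  ultimately show "(\<lambda>n. dk (real k) (Suc n) * real (Suc n) powr (-2)) sums Re (zeta 2 ^ k)"
    by (simp only:)
  have "norm (zeta 2) \<le> 3" using norm_zeta_le[of 2] by simp
  then have "norm (zeta 2 ^ k) \<le> 3 ^ k" unfolding norm_power by (intro power_mono) auto
  then show "Re (zeta 2 ^ k) \<le> 3 ^ k" using complex_Re_le_cmod order_trans by blast
qed

lemma zeta_power_tail:
  assumes "k \<ge> 1"
  obtains \<tau> :: "nat \<Rightarrow> real" where "\<tau> \<longlonglongrightarrow> 0"
    "\<And>N s. Re s \<ge> 2 \<Longrightarrow>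
       norm (zeta s ^ k - (\<Sum>n=1..N. of_real (dk (real k) n) * of_nat n powr (-s))) \<le> \<tau> N"
proof
  define b where "b = (\<lambda>n. dk (real k) (Suc n) * real (Suc n) powr (-2))"
  have b: "b sums Re (zeta 2 ^ k)" using dk_series_at_2(1)[OF assms] by (simp add: b_def)
  then have bs: "summable b" by (rule sums_summable)
  define \<tau> where "\<tau> = (\<lambda>N. \<Sum>i. b (i + N))"
  have \<tau>: "\<tau> N = Re (zeta 2 ^ k) - (\<Sum>i<N. b i)" for N
    unfolding \<tau>_def using suminf_minus_initial_segment[OF bs, of N] sums_unique[OF b] by simp
  have "(\<lambda>N. Re (zeta 2 ^ k) - (\<Sum>i<N. b i)) \<longlonglongrightarrow> Re (zeta 2 ^ k) - Re (zeta 2 ^ k)"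
    using b unfolding sums_def by (intro tendsto_intros)
  then show "\<tau> \<longlonglongrightarrow> 0" unfolding \<tau>[symmetric] by simp
  fix N s assume s: "Re s \<ge> 2"
  define f where "f = (\<lambda>n. of_real (dk (real k) (Suc n)) * of_nat (Suc n) powr (-s))"
  have f: "f sums zeta s ^ k" unfolding f_def using s assms by (intro zeta_power_sums) auto
  have fb: "norm (f n) \<le> b n" for n
  proof -
    have "norm (f n) = dk (real k) (Suc n) * real (Suc n) powr (- Re s)"
      using dk_nonneg[OF assms, of "Suc n"]
      by (simp add: f_def norm_mult norm_powr_real_powr del: of_nat_Suc)
    also have "\<dots> \<le> b n" unfolding b_def using s dk_nonneg[OF assms, of "Suc n"]
      by (intro mult_left_mono powr_mono) auto
    finally show ?thesis .
  qed
  have "(\<Sum>n=1..N. of_real (dk (real k) n) * of_nat n powr (-s)) = (\<Sum>n<N. f n)"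
    using sum.shift_bounds_Suc_ivl[of "\<lambda>n. of_real (dk (real k) n) * of_nat n powr (-s)" 0 N]
    by (simp add: f_def atLeast0LessThan atLeastLessThanSuc_atLeastAtMost)
  then have "zeta s ^ k - (\<Sum>n=1..N. of_real (dk (real k) n) * of_nat n powr (-s)) = (\<Sum>i. f (i + N))"
    using suminf_minus_initial_segment[OF sums_summable[OF f], of N] sums_unique[OF f] by simp
  also have "norm \<dots> \<le> \<tau> N"
    unfolding \<tau>_def using fb summable_ignore_initial_segment[OF bs, of N] by (intro norm_suminf_le) auto
  finally show "norm (zeta s ^ k - (\<Sum>n=1..N. of_real (dk (real k) n) * of_nat n powr (-s))) \<le> \<tau> N" .
qed

section \<open>Peaks of zeta and moments\<close>

lemma norm_zeta_le_linear:
  assumes "Re s \<ge> 1/4" "Im s \<ge> 1"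
  shows "norm (zeta s) \<le> 5 * norm s"
proof -
  have "1 \<le> \<bar>Im (s - 1)\<bar>" using assms by simp
  then have s1: "norm (s - 1) \<ge> 1" using abs_Im_le_cmod order_trans by blast
  have "norm (zeta s) \<le> norm s / norm (s - 1) + norm s / Re s"
    using assms s1 by (intro norm_zeta_le) auto
  also have "\<dots> \<le> norm s / 1 + norm s / (1/4)"
    using assms s1 by (intro add_mono divide_left_mono) auto
  finally show ?thesis by simp
qed

lemma zeta_continuous_line:
  assumes "\<sigma> > 0"
  shows "continuous_on {0<..} (\<lambda>t. zeta (Complex \<sigma> t))"
proof (rule continuous_on_compose2[OF holomorphic_on_imp_continuous_on[OF zeta_holomorphic]])
  show "continuous_on {0<..} (Complex \<sigma>)" unfolding Complex_eq by (intro continuous_intros)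
  show "Complex \<sigma> ` {0<..} \<subseteq> {s. 0 < Re s} - {1}"
    using assms by (auto simp: complex_eq_iff)
qed

text \<open>Cauchy's inequality on discs of radius 1/4, which stay in Re s >= 1/4 because \<sigma> >
  1/2. There |zeta| <= 5 * 4T by the linear bound, and 20T divided by 1/4 is 80T.\<close>

lemma zeta_lipschitz_line:
  assumes "1/2 < \<sigma>" "\<sigma> < 1" "T \<ge> 2" "t \<in> {T..2*T}" "u \<in> {T..2*T}"
  shows "norm (zeta (Complex \<sigma> t) - zeta (Complex \<sigma> u)) \<le> 80 * T * \<bar>t - u\<bar>"
proof -
  define S where "S = closed_segment (Complex \<sigma> T) (Complex \<sigma> (2*T))"
  have in_S: "Complex \<sigma> v \<in> S" if "v \<in> {T..2*T}" for v
    unfolding S_def in_segment using that assms(3)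
    by (intro exI[of _ "(v - T) / T"]) (auto simp: complex_eq_iff field_simps)
  have S_D: "Re z = \<sigma> \<and> Im z \<in> {T..2*T}" if z: "z \<in> S" for z
  proof -
    obtain w where w: "0 \<le> w" "w \<le> 1" "z = (1 - w) *\<^sub>R Complex \<sigma> T + w *\<^sub>R Complex \<sigma> (2*T)"
      using z by (auto simp: S_def in_segment)
    have "Im z = T + w * T" "Re z = \<sigma>" unfolding w(3) by (simp_all add: algebra_simps)
    moreover have "0 \<le> w * T" "w * T \<le> 1 * T" using w assms by (auto intro!: mult_right_mono)
    ultimately show ?thesis by auto
  qed
  have opn: "open ({s. 0 < Re s} - {1::complex})" by (intro open_Diff open_halfspace_Re_gt) auto
  have "norm (zeta (Complex \<sigma> t) - zeta (Complex \<sigma> u)) \<le> (80 * T) * norm (Complex \<sigma> t - Complex \<sigma> u)"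
  proof (rule field_differentiable_bound[where S = S and f' = "deriv zeta"])
    fix z assume "z \<in> S"
    then have z: "Re z = \<sigma>" "T \<le> Im z" "Im z \<le> 2 * T" using S_D by auto
    have zdom: "z \<in> {s. 0 < Re s} - {1}" using z assms by auto
    show "(zeta has_field_derivative deriv zeta z) (at z within S)"
      using holomorphic_derivI[OF zeta_holomorphic opn zdom] .
    have sub: "cball z (1/4) \<subseteq> {s. 0 < Re s} - {1}"
      and ball_bd: "\<And>x. x \<in> cball z (1/4) \<Longrightarrow> norm (zeta x) \<le> 20 * T"
    proof -
      have *: "Re x \<ge> 1/4 \<and> Im x \<ge> 1 \<and> norm x \<le> 4 * T" if "x \<in> cball z (1/4)" for x
      proof -
        have n: "norm (z - x) \<le> 1/4" using that by (simp add: dist_norm)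
        then have "\<bar>Re (z - x)\<bar> \<le> 1/4" "\<bar>Im (z - x)\<bar> \<le> 1/4"
          using abs_Re_le_cmod abs_Im_le_cmod order_trans by blast+
        moreover have "norm z \<le> \<bar>Re z\<bar> + \<bar>Im z\<bar>" by (rule cmod_le)
        moreover have "norm x \<le> norm z + norm (z - x)" using norm_triangle_ineq4[of z "z - x"] by simp
        ultimately show ?thesis using z n assms unfolding minus_complex.sel
          by (intro conjI) linarith+
      qed
      show "cball z (1/4) \<subseteq> {s. 0 < Re s} - {1}" using * by fastforce
      show "norm (zeta x) \<le> 20 * T" if "x \<in> cball z (1/4)" for x
        using norm_zeta_le_linear[of x] *[OF that] by linarith
    qed
    have hol: "zeta holomorphic_on cball z (1/4)"
      using zeta_holomorphic sub by (rule holomorphic_on_subset)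
    have "norm ((deriv ^^ 1) zeta z) \<le> fact 1 * (20 * T) / (1/4) ^ 1"
    proof (rule Cauchy_inequality)
      show "zeta holomorphic_on ball z (1/4)" by (rule holomorphic_on_subset[OF hol ball_subset_cball])
      show "continuous_on (cball z (1/4)) zeta" using hol by (rule holomorphic_on_imp_continuous_on)
    qed (use ball_bd in \<open>auto simp: dist_norm\<close>)
    then show "norm (deriv zeta z) \<le> 80 * T" by simp
  qed (use in_S assms in \<open>auto simp: S_def\<close>)
  also have "Complex \<sigma> t - Complex \<sigma> u = \<i> * of_real (t - u)" by (simp add: complex_eq_iff)
  finally show ?thesis by (simp add: norm_mult del: of_real_diff)
qed

lemma peak_le_moment:
  assumes "1/2 < \<sigma>" "\<sigma> < 1" "T \<ge> 2" "t \<in> {T..2*T}" "norm (zeta (Complex \<sigma> t)) \<ge> 1"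
  shows "(norm (zeta (Complex \<sigma> t)) / 2) ^ (2*k) \<le> 160 * T\<^sup>2 * moment \<sigma> k T"
proof -
  define M where "M = norm (zeta (Complex \<sigma> t))"
  define r where "r = 1 / (160 * T)" \<comment> \<open>\<open>zeta\<close> varies by at most \<open>1/2\<close> over a length \<open>r\<close>\<close>
  have r: "r > 0" "r \<le> T / 2" using assms by (auto simp: r_def field_simps intro: order_trans[OF _ mult_mono[of 2 T 160 "T * 80"]])
  \<comment> \<open>The interval goes to whichever side of t stays inside [T, 2T];
    \<open>r <= T / 2\<close> leaves room on one of them.\<close>
  obtain a b where ab: "b - a = r" "{a..b} \<subseteq> {T..2*T}" "\<And>u. u \<in> {a..b} \<Longrightarrow> \<bar>t - u\<bar> \<le> r"
  proof (cases "t + r \<le> 2 * T")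
    case True
    show ?thesis by (rule that[of "t + r" t]) (use True assms r in auto)
  next
    case False
    show ?thesis by (rule that[of t "t - r"]) (use False assms r in auto)
  qed
  define f where "f = (\<lambda>u. norm (zeta (Complex \<sigma> u)) ^ (2*k))"
  have cont: "continuous_on {T..2*T} f"
    unfolding f_def using assms
    by (intro continuous_intros continuous_on_subset[OF zeta_continuous_line]) auto
  have "(M / 2) ^ (2*k) * r = integral {a..b} (\<lambda>u. (M / 2) ^ (2*k))"
    using ab r by (simp add: mult.commute)
  also have "\<dots> \<le> integral {a..b} f"
  proof (rule integral_le)
    show "f integrable_on {a..b}"
      by (rule integrable_continuous_interval, rule continuous_on_subset[OF cont ab(2)])
    fix u assume u: "u \<in> {a..b}"
    have "norm (zeta (Complex \<sigma> t) - zeta (Complex \<sigma> u)) \<le> 80 * T * \<bar>t - u\<bar>"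
      using assms u ab by (intro zeta_lipschitz_line) auto
    also have "\<dots> \<le> 80 * T * r" using ab(3)[OF u] assms by (intro mult_left_mono) auto
    also have "\<dots> = 1/2" using assms by (simp add: r_def)
    \<comment> \<open>The variation is at most 1/2 and M >= 1, so at least M/2 remains.\<close>
    finally have "M / 2 \<le> norm (zeta (Complex \<sigma> u))"
      using norm_triangle_ineq2[of "zeta (Complex \<sigma> t)" "zeta (Complex \<sigma> u)"] assms(5)
      by (simp add: M_def; linarith)
    then show "(M / 2) ^ (2*k) \<le> f u" unfolding f_def by (intro power_mono) (auto simp: M_def)
  qed auto
  also have "\<dots> \<le> integral {T..2*T} f"
    using ab(2) cont continuous_on_subset[OF cont ab(2)]
    by (intro integral_subset_le integrable_continuous_interval) (auto simp: f_def)
  also have "\<dots> = T * moment \<sigma> k T" using assms by (simp add: moment_def f_def)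
  finally have "(M / 2) ^ (2*k) \<le> 160 * T * (T * moment \<sigma> k T)"
    using assms by (simp add: r_def field_simps)
  then show ?thesis by (simp add: M_def power2_eq_square mult_ac)
qed

text \<open>With k close to \<open>(log T) powr \<delta>\<close>, taking the 2k-th root turns the
  polynomial loss of \<open>peak_le_moment\<close> into a contribution O(log T / k) to log |zeta|.
  This is O(\<open>(log T) powr (1 - \<delta>)\<close>), the same bound as for the diagonal
  sum.\<close>

lemma LT_le_of_moment_asymp:
  assumes \<sigma>: "1/2 < \<sigma>" "\<sigma> < 1" and \<delta>: "0 < \<delta>" "\<delta> \<le> \<sigma>"
    and asy: "moment_asymp \<sigma> (\<lambda>T. ln T powr \<delta>)"
  shows "\<exists>C T0. \<forall>T\<ge>T0. LT T \<sigma> \<le> C * ln T powr (1 - \<delta>)"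
proof -
  define A where "A = 16 / (1 - \<sigma>) + 4 / (2 * \<sigma> - 1)"
  have A0: "A \<ge> 0" using \<sigma> by (simp add: A_def)
  \<comment> \<open>Relative error 1 is enough: only an upper bound for the moment, up to a factor
    2, is used.\<close>
  obtain T1 where T1: "\<And>T k. T \<ge> T1 \<Longrightarrow> 1 \<le> k \<Longrightarrow> real k \<le> ln T powr \<delta> \<Longrightarrow>
      \<bar>moment \<sigma> k T - diag_sum \<sigma> k\<bar> \<le> 1 * diag_sum \<sigma> k"
    using asy unfolding moment_asymp_def by (metis zero_less_one)
  \<comment> \<open>320 = 2 * 160 collects the constants of the moment bound and the peak bound;
    they are absorbed into one more factor T.\<close>
  define T0 where "T0 = max T1 320"
  define C where "C = 4 + A + \<bar>Sup ({} :: real set)\<bar>"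
  have "LT T \<sigma> \<le> C * ln T powr (1 - \<delta>)" if T: "T \<ge> T0" for T
  proof -
    have T320: "T \<ge> 320" "T \<ge> T1" using T by (auto simp: T0_def)
    define L where "L = ln T"
    have "exp (1::real) \<le> T" using exp_le T320 by linarith
    then have L1: "L \<ge> 1" unfolding L_def using T320 by (subst ln_ge_iff) auto
    have Lp: "L powr (1 - \<delta>) \<ge> 1" using L1 \<delta> \<sigma> by (intro ge_one_powr_ge_zero) auto
    have Ld: "L powr \<delta> \<ge> 1" using L1 \<delta> by (intro ge_one_powr_ge_zero) auto
    define k where "k = nat \<lfloor>L powr \<delta>\<rfloor>"
    have k1: "k \<ge> 1" using Ld by (simp add: k_def le_nat_iff)
    have kL: "real k \<le> L powr \<delta>" "L powr \<delta> / 2 \<le> real k"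
      using Ld k1 by (simp_all add: k_def) linarith+
    have D: "diag_sum \<sigma> k \<le> exp (A * real k powr (1 / \<sigma>))" "diag_sum \<sigma> k \<ge> 1"
      using diag_sum_le[OF \<sigma> k1] diag_sum_ge_1[OF \<sigma> k1] by (auto simp: A_def)
    have mom: "moment \<sigma> k T \<le> 2 * exp (A * real k powr (1 / \<sigma>))"
      using T1[of T k] T320 k1 kL D by (simp add: L_def abs_le_iff)
    have k_pow: "real k powr (1 / \<sigma>) \<le> real k * L powr (1 - \<delta>)"
    proof -
      have "real k powr (1 / \<sigma>) = real k powr 1 * real k powr (1 / \<sigma> - 1)"
        using k1 by (subst powr_add[symmetric]) auto
      also have "real k powr (1 / \<sigma> - 1) \<le> (L powr \<delta>) powr (1 / \<sigma> - 1)"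
        using kL \<sigma> by (intro powr_mono2) (auto simp: field_simps)
      also have "\<dots> = L powr (\<delta> * (1 / \<sigma> - 1))" by (simp add: powr_powr)
      \<comment> \<open>The inequality \<open>\<delta> * (1 / \<sigma> - 1) <= 1 - \<delta>\<close>
        is precisely \<delta> <= \<sigma>.\<close>
      also have "\<dots> \<le> L powr (1 - \<delta>)"
        using L1 \<sigma> \<delta> by (intro powr_mono) (auto simp: field_simps)
      finally show ?thesis using k1 by (simp add: mult_left_mono)
    qed
    have point: "ln (norm (zeta (Complex \<sigma> t))) \<le> C * L powr (1 - \<delta>)"
      if t: "t \<in> {T..2*T}" and nz: "zeta (Complex \<sigma> t) \<noteq> 0" for t
    proof (cases "norm (zeta (Complex \<sigma> t)) \<ge> 1")
      case False
      then have "ln (norm (zeta (Complex \<sigma> t))) \<le> 0" using nz by simp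
      also have "0 \<le> C * L powr (1 - \<delta>)" using A0 by (simp add: C_def)
      finally show ?thesis .
    next
      case True
      define M where "M = norm (zeta (Complex \<sigma> t))"
      have M: "M \<ge> 1" using True by (simp add: M_def)
      have "(M / 2) ^ (2*k) \<le> 160 * T\<^sup>2 * moment \<sigma> k T"
        unfolding M_def using True t T320 \<sigma> by (intro peak_le_moment) auto
      also have "\<dots> \<le> 160 * T\<^sup>2 * (2 * exp (A * real k powr (1 / \<sigma>)))"
        using mom by (intro mult_left_mono) auto
      also have "\<dots> = 320 * T\<^sup>2 * exp (A * real k powr (1 / \<sigma>))" by simp
      also have "\<dots> \<le> T * T\<^sup>2 * exp (A * real k powr (1 / \<sigma>))"
        using T320 by (intro mult_right_mono) auto
      also have "\<dots> = exp (3 * L + A * real k powr (1 / \<sigma>))"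
      proof -
        have "T * T\<^sup>2 = exp L ^ 3" using T320 by (simp add: L_def power3_eq_cube power2_eq_square)
        also have "\<dots> = exp (3 * L)" by (simp add: exp_of_nat_mult[symmetric])
        finally show ?thesis by (simp add: exp_add)
      qed
      finally have "ln ((M / 2) ^ (2*k)) \<le> ln (exp (3 * L + A * real k powr (1 / \<sigma>)))"
        using M by (intro ln_mono) auto
      then have "ln ((M / 2) ^ (2*k)) \<le> 3 * L + A * real k powr (1 / \<sigma>)" by simp
      then have "2 * real k * (ln M - ln 2) \<le> 3 * L + A * real k powr (1 / \<sigma>)"
        using M by (simp add: ln_realpow ln_div)
      also have "3 * L \<le> 6 * real k * L powr (1 - \<delta>)"
      proof -
        have "L = L powr \<delta> * L powr (1 - \<delta>)" using L1 by (simp add: powr_add[symmetric])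
        also have "\<dots> \<le> (2 * real k) * L powr (1 - \<delta>)" using kL by (intro mult_right_mono) auto
        finally show ?thesis by simp
      qed
      also have "A * real k powr (1 / \<sigma>) \<le> A * (real k * L powr (1 - \<delta>))"
        using k_pow A0 by (rule mult_left_mono)
      finally have "real k * (2 * (ln M - ln 2)) \<le> real k * (6 * L powr (1 - \<delta>) + A * L powr (1 - \<delta>))"
        by (simp add: algebra_simps)
      then have "2 * (ln M - ln 2) \<le> 6 * L powr (1 - \<delta>) + A * L powr (1 - \<delta>)"
        using k1 by simp
      moreover have "ln 2 \<le> L powr (1 - \<delta>)" using Lp ln_le_minus_one[of "2::real"] by simp
      moreover have "0 \<le> A * L powr (1 - \<delta>)" using A0 by simp
      ultimately have "ln M \<le> 4 * L powr (1 - \<delta>) + A * L powr (1 - \<delta>)"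
        by (smt (verit, best))
      also have "\<dots> = (4 + A) * L powr (1 - \<delta>)" by (simp add: algebra_simps)
      also have "\<dots> \<le> C * L powr (1 - \<delta>)" by (intro mult_right_mono) (auto simp: C_def)
      finally show ?thesis by (simp add: M_def)
    qed
    show ?thesis
    proof (cases "{t. T \<le> t \<and> t \<le> 2*T \<and> zeta (Complex \<sigma> t) \<noteq> 0} = {}")
      case True \<comment> \<open>then \<open>LT T \<sigma>\<close> is the junk value \<open>Sup {}\<close>\<close>
      have "LT T \<sigma> \<le> \<bar>Sup ({} :: real set)\<bar>" unfolding LT_def True by simp
      also have "\<dots> \<le> C * 1" using A0 by (simp add: C_def)
      also have "\<dots> \<le> C * ln T powr (1 - \<delta>)"
        using Lp A0 unfolding L_def by (intro mult_left_mono) (auto simp: C_def)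
      finally show ?thesis .
    next
      case False
      then show ?thesis unfolding LT_def using point by (intro cSUP_least) (auto simp: L_def)
    qed
  qed
  then show ?thesis by blast
qed

section \<open>Smoothing by a contour integral\<close>

text \<open>X to the power w is written through \<open>exp\<close>, so that the numerator is visibly
  entire. The pole at 0 has residue 1, and in vertical strips the kernel decays like
  \<open>exp (-(Im w)^2)\<close>.\<close>

definition smoothing_kernel :: "real \<Rightarrow> complex \<Rightarrow> complex" where
  "smoothing_kernel X w = exp (w * of_real (ln X) + w\<^sup>2) / w"

text \<open>Only the edge Re w = 3 of the rectangle is kept, where s + w lies in the region of
  absolute convergence. The other three edges measure the distance from \<open>f 0\<close>.\<close>

definition smoothed :: "real \<Rightarrow> real \<Rightarrow> (complex \<Rightarrow> complex) \<Rightarrow> complex" where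
  "smoothed X H f = contour_integral (linepath (Complex 3 (-H)) (Complex 3 H))
     (\<lambda>w. f w * smoothing_kernel X w) / (2 * of_real pi * \<i>)"

lemma norm_smoothing_kernel_le:
  assumes "X > 0" "norm w \<ge> d" "d > 0"
  shows "norm (smoothing_kernel X w) \<le> X powr Re w * exp ((Re w)\<^sup>2 - (Im w)\<^sup>2) / d"
proof -
  have "norm (smoothing_kernel X w) = exp (Re w * ln X + ((Re w)\<^sup>2 - (Im w)\<^sup>2)) / norm w"
    by (simp add: smoothing_kernel_def norm_divide power2_eq_square)
  also have "\<dots> = X powr Re w * exp ((Re w)\<^sup>2 - (Im w)\<^sup>2) / norm w"
    using assms by (simp add: powr_def exp_add)
  also have "\<dots> \<le> X powr Re w * exp ((Re w)\<^sup>2 - (Im w)\<^sup>2) / d"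
    using assms by (intro divide_left_mono) (auto intro: mult_pos_pos order_less_le_trans)
  finally show ?thesis .
qed

lemma smoothing_kernel_continuous:
  assumes "0 \<notin> S" shows "continuous_on S (smoothing_kernel X)"
  unfolding smoothing_kernel_def[abs_def] using assms by (intro continuous_intros) auto

lemma Re_right_segment: "Re w = 3" if "w \<in> closed_segment (Complex 3 (-H)) (Complex 3 H)"
  using that by (auto simp: closed_segment_same_Re)

lemma right_segment_nz: "0 \<notin> closed_segment (Complex 3 (-H)) (Complex 3 H)"
  using Re_right_segment by fastforce

lemma smoothed_integrable:
  assumes "continuous_on (closed_segment (Complex 3 (-H)) (Complex 3 H)) f"
  shows "(\<lambda>w. f w * smoothing_kernel X w) contour_integrable_on linepath (Complex 3 (-H)) (Complex 3 H)"
  using assms smoothing_kernel_continuous[OF right_segment_nz]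
  by (intro contour_integrable_continuous_linepath continuous_intros)

text \<open>\<open>exp 9\<close> bounds the Gaussian factor at real part 3, and the length 2H
  divided by 2 pi is at most H.\<close>

lemma norm_smoothed_le:
  assumes "X > 0" "H \<ge> 0" "continuous_on (closed_segment (Complex 3 (-H)) (Complex 3 H)) f"
    "\<And>w. Re w = 3 \<Longrightarrow> norm (f w) \<le> B" "B \<ge> 0"
  shows "norm (smoothed X H f) \<le> B * (H * X powr 3 * exp 9)"
proof -
  have "norm (contour_integral (linepath (Complex 3 (-H)) (Complex 3 H)) (\<lambda>w. f w * smoothing_kernel X w))
     \<le> (B * (X powr 3 * exp 9)) * norm (Complex 3 H - Complex 3 (-H))"
  proof (rule contour_integral_bound_linepath[OF smoothed_integrable[OF assms(3)]])
    fix w assume w: "w \<in> closed_segment (Complex 3 (-H)) (Complex 3 H)"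
    have Re: "Re w = 3" using w by (rule Re_right_segment)
    have "norm w \<ge> \<bar>Re w\<bar>" by (rule abs_Re_le_cmod)
    then have "norm (smoothing_kernel X w) \<le> X powr Re w * exp ((Re w)\<^sup>2 - (Im w)\<^sup>2) / 1"
      using assms Re by (intro norm_smoothing_kernel_le) auto
    also have "\<dots> \<le> X powr 3 * exp 9" unfolding Re by (simp add: mult_left_mono)
    finally show "norm (f w * smoothing_kernel X w) \<le> B * (X powr 3 * exp 9)"
      unfolding norm_mult using assms Re by (intro mult_mono) auto
  qed (use assms in auto)
  also have "Complex 3 H - Complex 3 (-H) = of_real (2 * H) * \<i>" by (simp add: complex_eq_iff)
  also have "norm \<dots> = 2 * H" using assms by (simp add: norm_mult)
  finally have "norm (contour_integral (linepath (Complex 3 (-H)) (Complex 3 H)) (\<lambda>w. f w * smoothing_kernel X w)) / (2 * pi)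
      \<le> (B * (X powr 3 * exp 9)) * (2 * H) / (2 * pi)"
    by (intro divide_right_mono) auto
  then have "norm (smoothed X H f) \<le> (B * (X powr 3 * exp 9)) * (2 * H) / (2 * pi)"
    by (simp only: smoothed_def norm_divide norm_mult norm_ii norm_of_real norm_numeral abs_of_pos[OF pi_gt_zero] mult_1_right)
  also have "\<dots> = (B * (H * X powr 3 * exp 9)) / pi" by (simp add: field_simps)
  also have "\<dots> \<le> (B * (H * X powr 3 * exp 9)) / 1"
    using assms pi_gt3 by (intro divide_left_mono) auto
  finally show ?thesis by simp
qed

text \<open>By Cauchy's formula the full boundary integral is \<open>2 pi i * f 0\<close>, so the
  difference consists of the three remaining edges. The left edge, at distance \<alpha> from the
  pole, gives \<open>H / \<alpha> * X powr (-\<alpha>)\<close>; the horizontal edges give the term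
  with \<open>exp (9 - H^2)\<close>.\<close>

lemma smoothed_approx:
  assumes X: "X \<ge> 1" and H: "H \<ge> 1" and \<alpha>: "0 < \<alpha>" "\<alpha> \<le> 1" and M: "M \<ge> 0"
    and U: "convex U" "open U" "cbox (Complex (-\<alpha>) (-H)) (Complex 3 H) \<subseteq> U" "f holomorphic_on U"
    and f: "\<And>w. Re w \<in> {-\<alpha>..3} \<Longrightarrow> Im w \<in> {-H..H} \<Longrightarrow> norm (f w) \<le> M"
  shows "norm (smoothed X H f - f 0) \<le> M * (H / \<alpha> * X powr (-\<alpha>) + 2 * X powr 3 * exp (9 - H\<^sup>2))"
proof -
  define a1 where "a1 = Complex (-\<alpha>) (-H)"
  define a2 where "a2 = Complex 3 (-H)"
  define a3 where "a3 = Complex 3 H"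
  define a4 where "a4 = Complex (-\<alpha>) H"
  define g where "g = (\<lambda>w. f w * smoothing_kernel X w)"
  define I where "I = (\<lambda>a b. contour_integral (linepath a b) g)"
  have rp: "rectpath a1 a3 = linepath a1 a2 +++ linepath a2 a3 +++ linepath a3 a4 +++ linepath a4 a1"
    by (simp add: rectpath_def a1_def a2_def a3_def a4_def Let_def)
  have box0: "0 \<in> box a1 a3" using \<alpha> H by (simp add: a1_def a3_def in_box_complex_iff)
  have corners: "a1 \<in> cbox a1 a3" "a2 \<in> cbox a1 a3" "a3 \<in> cbox a1 a3" "a4 \<in> cbox a1 a3"
    using \<alpha> H by (auto simp: a1_def a2_def a3_def a4_def in_cbox_complex_iff)
  have seg_sub: "closed_segment a b \<subseteq> cbox a1 a3" if "a \<in> cbox a1 a3" "b \<in> cbox a1 a3" for a b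
    using that by (intro closed_segment_subset) auto
  have s1: "Im w = - H" if "w \<in> closed_segment a1 a2" for w
    using that by (auto simp: closed_segment_same_Im a1_def a2_def)
  have s2: "Re w = 3" if "w \<in> closed_segment a2 a3" for w
    using that by (auto simp: closed_segment_same_Re a2_def a3_def)
  have s3: "Im w = H" if "w \<in> closed_segment a3 a4" for w
    using that by (auto simp: closed_segment_same_Im a3_def a4_def)
  have s4: "Re w = - \<alpha>" if "w \<in> closed_segment a4 a1" for w
    using that by (auto simp: closed_segment_same_Re a4_def a1_def)
  have contf: "continuous_on (cbox a1 a3) f"
    using U holomorphic_on_imp_continuous_on continuous_on_subset unfolding a1_def a3_def by blast
  have int: "g contour_integrable_on linepath a b" if "closed_segment a b \<subseteq> cbox a1 a3" "0 \<notin> closed_segment a b" for a b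
    unfolding g_def using that continuous_on_subset[OF contf] smoothing_kernel_continuous
    by (intro contour_integrable_continuous_linepath continuous_intros) auto
  have i1: "g contour_integrable_on linepath a1 a2"
    using s1[of 0] H by (intro int seg_sub corners) auto
  have i2: "g contour_integrable_on linepath a2 a3"
    using s2[of 0] H by (intro int seg_sub corners) auto
  have i3: "g contour_integrable_on linepath a3 a4"
    using s3[of 0] H by (intro int seg_sub corners) auto
  have i4: "g contour_integrable_on linepath a4 a1"
    using s4[of 0] \<alpha> by (intro int seg_sub corners) auto
  have "(g has_contour_integral (I a1 a2 + (I a2 a3 + (I a3 a4 + I a4 a1)))) (rectpath a1 a3)"
    unfolding rp I_def
    by (intro has_contour_integral_join has_contour_integral_integral i1 i2 i3 i4 valid_path_join valid_path_linepath)
       auto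
  moreover have "(g has_contour_integral (2 * of_real pi * \<i> * f 0)) (rectpath a1 a3)"
  proof -
    \<comment> \<open>With the pole of the kernel split off, the remaining factor F is holomorphic
      on U and \<open>F 0 = f 0\<close>.\<close>
    define F where "F = (\<lambda>w. f w * exp (w * of_real (ln X) + w\<^sup>2))"
    have "((\<lambda>w. F w / (w - 0)) has_contour_integral (of_real (2 * pi) * \<i> * winding_number (rectpath a1 a3) 0 * F 0)) (rectpath a1 a3)"
    proof (rule Cauchy_integral_formula_convex_simple[OF U(1)])
      show "F holomorphic_on U" unfolding F_def using U(4) by (intro holomorphic_intros)
      show "0 \<in> interior U" using box0 box_subset_cbox[of a1 a3] U(2,3)
        by (auto simp: interior_open a1_def a3_def)
      show "path_image (rectpath a1 a3) \<subseteq> U - {0}"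
      proof -
        have "path_image (rectpath a1 a3) \<subseteq> cbox a1 a3" using corners \<alpha> H
          by (intro path_image_rectpath_subset_cbox) (auto simp: a1_def a3_def)
        moreover have "path_image (rectpath a1 a3) \<inter> box a1 a3 = {}" using \<alpha> H
          by (intro path_image_rectpath_inter_box) (auto simp: a1_def a3_def)
        ultimately show ?thesis using box0 U(3) by (auto simp: a1_def a3_def)
      qed
    qed auto
    then show ?thesis using winding_number_rectpath[OF box0]
      by (simp add: F_def g_def smoothing_kernel_def)
  qed
  ultimately have eq: "I a1 a2 + (I a2 a3 + (I a3 a4 + I a4 a1)) = 2 * of_real pi * \<i> * f 0"
    by (rule has_contour_integral_unique)
  have fM: "norm (f w) \<le> M" if "w \<in> cbox a1 a3" for w
    using that by (intro f) (auto simp: a1_def a3_def in_cbox_complex_iff)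
  have horiz: "norm (g w) \<le> M * (X powr 3 * exp (9 - H\<^sup>2))" if w: "w \<in> cbox a1 a3" "\<bar>Im w\<bar> = H" for w
  proof -
    have Re: "- \<alpha> \<le> Re w" "Re w \<le> 3" using w by (auto simp: a1_def a3_def in_cbox_complex_iff)
    have "norm w \<ge> 1" using abs_Im_le_cmod[of w] w H by linarith
    then have "norm (smoothing_kernel X w) \<le> X powr Re w * exp ((Re w)\<^sup>2 - (Im w)\<^sup>2) / 1"
      using X by (intro norm_smoothing_kernel_le) auto
    also have "\<dots> \<le> X powr 3 * exp (9 - H\<^sup>2) / 1"
    proof (intro divide_right_mono mult_mono powr_mono)
      have "\<bar>Re w\<bar> \<le> 3" using Re \<alpha> by auto
      then have "(Re w)\<^sup>2 \<le> 3\<^sup>2" using abs_le_square_iff[of "Re w" 3] by simp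
      moreover have "(Im w)\<^sup>2 = H\<^sup>2" using w(2) by (metis power2_abs)
      ultimately show "exp ((Re w)\<^sup>2 - (Im w)\<^sup>2) \<le> exp (9 - H\<^sup>2)" by simp
    qed (use Re X in auto)
    finally show ?thesis unfolding g_def norm_mult using fM[OF w(1)] M by (intro mult_mono) auto
  qed
  have len: "norm (a2 - a1) \<le> 4" "norm (a4 - a3) \<le> 4" "norm (a1 - a4) = 2 * H"
  proof -
    have "a2 - a1 = of_real (3 + \<alpha>)" "a4 - a3 = of_real (- (3 + \<alpha>))" "a1 - a4 = of_real (- (2 * H)) * \<i>"
      by (auto simp: complex_eq_iff a1_def a2_def a3_def a4_def)
    then show "norm (a2 - a1) \<le> 4" "norm (a4 - a3) \<le> 4" "norm (a1 - a4) = 2 * H"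
      using \<alpha> H by (simp_all only: norm_mult norm_of_real norm_ii)
  qed
  define Q where "Q = M * (X powr 3 * exp (9 - H\<^sup>2))"
  have Q0: "Q \<ge> 0" using M by (simp add: Q_def)
  have b1: "norm (I a1 a2) \<le> Q * norm (a2 - a1)" unfolding I_def
  proof (rule contour_integral_bound_linepath[OF i1 Q0])
    fix w assume w: "w \<in> closed_segment a1 a2"
    show "norm (g w) \<le> Q"
      unfolding Q_def using seg_sub[OF corners(1,2)] s1[OF w] w H by (intro horiz) auto
  qed
  have b3: "norm (I a3 a4) \<le> Q * norm (a4 - a3)" unfolding I_def
  proof (rule contour_integral_bound_linepath[OF i3 Q0])
    fix w assume w: "w \<in> closed_segment a3 a4"
    show "norm (g w) \<le> Q"
      unfolding Q_def using seg_sub[OF corners(3,4)] s3[OF w] w H by (intro horiz) auto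
  qed
  define R where "R = M * (X powr (-\<alpha>) * exp 1 / \<alpha>)"
  have R0: "R \<ge> 0" using M \<alpha> by (simp add: R_def)
  have b4: "norm (I a4 a1) \<le> R * norm (a1 - a4)" unfolding I_def
  proof (rule contour_integral_bound_linepath[OF i4 R0])
    fix w assume w: "w \<in> closed_segment a4 a1"
    have Re: "Re w = - \<alpha>" using s4 w by auto
    have "norm w \<ge> \<alpha>" using abs_Re_le_cmod[of w] Re \<alpha> by simp
    then have "norm (smoothing_kernel X w) \<le> X powr Re w * exp ((Re w)\<^sup>2 - (Im w)\<^sup>2) / \<alpha>"
      using X \<alpha> by (intro norm_smoothing_kernel_le) auto
    also have "\<dots> \<le> X powr (-\<alpha>) * exp 1 / \<alpha>"
    proof (intro divide_right_mono mult_mono)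
      have "\<alpha>\<^sup>2 \<le> 1" using \<alpha> by (simp add: power_le_one)
      then have "\<alpha>\<^sup>2 - (Im w)\<^sup>2 \<le> 1" using zero_le_power2[of "Im w"] by linarith
      then show "exp ((Re w)\<^sup>2 - (Im w)\<^sup>2) \<le> exp 1" unfolding Re by simp
    qed (use Re \<alpha> in auto)
    finally show "norm (g w) \<le> R" unfolding g_def norm_mult R_def
      using fM[of w] w seg_sub[OF corners(4,1)] M by (intro mult_mono) auto
  qed
  have "smoothed X H f - f 0 = - (I a1 a2 + I a3 a4 + I a4 a1) / (2 * of_real pi * \<i>)"
  proof -
    have "smoothed X H f = I a2 a3 / (2 * of_real pi * \<i>)"
      by (simp add: smoothed_def I_def g_def a2_def a3_def)
    moreover have "f 0 = (I a1 a2 + (I a2 a3 + (I a3 a4 + I a4 a1))) / (2 * of_real pi * \<i>)"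
      unfolding eq by simp
    ultimately show ?thesis by (simp add: diff_divide_distrib add_divide_distrib)
  qed
  then have "norm (smoothed X H f - f 0) = norm (I a1 a2 + I a3 a4 + I a4 a1) / (2 * pi)"
    by (simp only: norm_divide norm_minus_cancel norm_mult norm_ii norm_of_real norm_numeral
          abs_of_pos[OF pi_gt_zero] mult_1_right)
  also have "\<dots> \<le> (Q * 4 + Q * 4 + R * (2 * H)) / (2 * pi)"
  proof (rule divide_right_mono)
    have "norm (I a1 a2 + I a3 a4 + I a4 a1) \<le> norm (I a1 a2) + norm (I a3 a4) + norm (I a4 a1)"
      by (meson norm_triangle_ineq norm_triangle_mono order_refl)
    also have "\<dots> \<le> Q * 4 + Q * 4 + R * (2 * H)"
      using order_trans[OF b1 mult_left_mono[OF len(1) Q0]] order_trans[OF b3 mult_left_mono[OF len(2) Q0]] b4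
      unfolding len(3) by linarith
    finally show "norm (I a1 a2 + I a3 a4 + I a4 a1) \<le> Q * 4 + Q * 4 + R * (2 * H)" .
  qed simp
  also have "\<dots> = (4 * Q + R * H) / pi" by (simp add: field_simps)
  \<comment> \<open>The 3 from pi > 3 cancels against \<open>exp 1 <= 3\<close>, the bound for the
    Gaussian factor on the left edge; the horizontal edges keep 4/3 <= 2.\<close>
  also have "\<dots> \<le> (4 * Q + R * H) / 3"
    using Q0 R0 H pi_gt3 by (intro divide_left_mono) auto
  also have "\<dots> \<le> M * (H / \<alpha> * X powr (-\<alpha>) + 2 * X powr 3 * exp (9 - H\<^sup>2))"
  proof -
    have "R * H \<le> 3 * (M * (H / \<alpha> * X powr (-\<alpha>)))"
    proof -
      have "R * H = exp 1 * (M * (H / \<alpha> * X powr (-\<alpha>)))" by (simp add: R_def)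
      also have "\<dots> \<le> 3 * (M * (H / \<alpha> * X powr (-\<alpha>)))"
        using exp_le M H \<alpha> by (intro mult_right_mono) auto
      finally show ?thesis .
    qed
    moreover have "Q = M * (X powr 3 * exp (9 - H\<^sup>2))" by (simp add: Q_def)
    ultimately show ?thesis using Q0 by (simp add: algebra_simps)
  qed
  finally show ?thesis .
qed

section \<open>Mean squares of Dirichlet polynomials\<close>

lemma norm_integral_cis_le:
  assumes "\<mu> \<noteq> (0::real)" "a \<le> b"
  shows "norm (integral {a..b} (\<lambda>t. cis (- (t * \<mu>)))) \<le> 2 / \<bar>\<mu>\<bar>"
proof -
  define F where "F = (\<lambda>z::complex. \<i> * exp (- (z * of_real \<mu> * \<i>)) / of_real \<mu>)"
  have "((\<lambda>t. cis (- (t * \<mu>))) has_integral F (of_real b) - F (of_real a)) {a..b}"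
  proof (rule fundamental_theorem_of_calculus)
    fix x assume "x \<in> {a..b}"
    have "(F has_field_derivative \<i> * (exp (- (of_real x * of_real \<mu> * \<i>)) * (- (1 * of_real \<mu> * \<i>))) / of_real \<mu>)
            (at (of_real x))"
      unfolding F_def using assms by (auto intro!: derivative_eq_intros simp: field_simps)
    also have "\<i> * (exp (- (of_real x * of_real \<mu> * \<i>)) * (- (1 * of_real \<mu> * \<i>))) / of_real \<mu> = cis (- (x * \<mu>))"
      using assms by (simp add: cis_conv_exp mult_ac)
    finally show "((\<lambda>t. F (of_real t)) has_vector_derivative cis (- (x * \<mu>))) (at x within {a..b})"
      by (rule has_vector_derivative_real_field)
  qed fact
  then have "integral {a..b} (\<lambda>t. cis (- (t * \<mu>))) = F (of_real b) - F (of_real a)"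
    by (rule integral_unique)
  moreover have "norm (F (of_real x)) = 1 / \<bar>\<mu>\<bar>" for x
    by (simp add: F_def norm_divide norm_mult)
  ultimately show ?thesis
    using norm_triangle_ineq4[of "F (of_real b)" "F (of_real a)"] by simp
qed

text \<open>For integers a < b, \<open>ln (b/a) >= 1 - a/b >= 1/b\<close>. The bound by m n is
  generous but separates the variables, so that the off-diagonal double sum becomes a
  square.\<close>

lemma inverse_ln_diff_le:
  assumes "m \<ge> 1" "n \<ge> 1" "m \<noteq> n"
  shows "1 / \<bar>ln (real m) - ln (real n)\<bar> \<le> real m * real n"
proof -
  have *: "1 / (ln (real b) - ln (real a)) \<le> real a * real b" if "1 \<le> a" "a < b" for a b :: nat
  proof -
    have "ln (real a / real b) \<le> real a / real b - 1" using that by (intro ln_le_minus_one) auto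
    then have "1 - real a / real b \<le> ln (real b) - ln (real a)" using that by (simp add: ln_div)
    moreover have "1 / real b \<le> 1 - real a / real b" using that by (simp add: field_simps)
    ultimately have "1 / real b \<le> ln (real b) - ln (real a)" by simp
    moreover have pos: "1 / real b > 0" using that by simp
    ultimately have "1 / (ln (real b) - ln (real a)) \<le> 1 / (1 / real b)"
      by (intro divide_left_mono mult_pos_pos) linarith+
    also have "\<dots> \<le> real a * real b" using that by simp
    finally show ?thesis .
  qed
  show ?thesis
  proof (cases "m < n")
    case True
    then show ?thesis using *[of m n] assms by simp
  next
    case False
    then show ?thesis using *[of n m] assms by (simp add: mult.commute)
  qed
qed

text \<open>When the square is expanded, the diagonal contributes exactly \<open>T * |a n|^2\<close>
  for each n, while the pair (m, n) oscillates with frequency ln m - ln n. The error is weak in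
  general, yet bounded independently of N for coefficients decaying as fast as the smoothed
  ones.\<close>

lemma dirichlet_polynomial_mean_square:
  fixes a :: "nat \<Rightarrow> complex"
  assumes "T > 0"
  shows "\<bar>integral {T..2*T} (\<lambda>t. (norm (\<Sum>n=1..N. a n * cis (- (t * ln (real n)))))\<^sup>2)
            - T * (\<Sum>n=1..N. (norm (a n))\<^sup>2)\<bar> \<le> 2 * (\<Sum>n=1..N. norm (a n) * real n)\<^sup>2"
proof -
  define P where "P = (\<lambda>t. \<Sum>n=1..N. a n * cis (- (t * ln (real n))))"
  define c where "c = (\<lambda>m n. a m * cnj (a n))"
  define I where "I = (\<lambda>m n. integral {T..2*T} (\<lambda>t. cis (- (t * (ln (real m) - ln (real n))))))"
  have sq: "of_real ((norm (P t))\<^sup>2) = (\<Sum>m=1..N. \<Sum>n=1..N. c m n * cis (- (t * (ln (real m) - ln (real n)))))" for t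
  proof -
    have "of_real ((norm (P t))\<^sup>2) = P t * cnj (P t)" by (rule complex_norm_square)
    also have "\<dots> = (\<Sum>m=1..N. \<Sum>n=1..N. (a m * cis (- (t * ln (real m)))) * cnj (a n * cis (- (t * ln (real n)))))"
      unfolding P_def cnj_sum sum_product ..
    also have "\<dots> = (\<Sum>m=1..N. \<Sum>n=1..N. c m n * cis (- (t * (ln (real m) - ln (real n)))))"
    proof (intro sum.cong refl)
      fix m n
      have "cis (- (t * ln (real m))) * cis (t * ln (real n)) = cis (- (t * (ln (real m) - ln (real n))))"
        by (simp add: cis_mult algebra_simps)
      then show "(a m * cis (- (t * ln (real m)))) * cnj (a n * cis (- (t * ln (real n))))
         = c m n * cis (- (t * (ln (real m) - ln (real n))))"
        by (simp add: c_def cis_cnj mult_ac)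
    qed
    finally show ?thesis .
  qed
  have "((\<lambda>t. \<Sum>m=1..N. \<Sum>n=1..N. c m n * cis (- (t * (ln (real m) - ln (real n)))))
          has_integral (\<Sum>m=1..N. \<Sum>n=1..N. c m n * I m n)) {T..2*T}"
    unfolding I_def
    by (intro has_integral_sum has_integral_mult_right integrable_integral integrable_continuous_interval
          continuous_intros) auto
  then have "((\<lambda>t. complex_of_real ((norm (P t))\<^sup>2)) has_integral (\<Sum>m=1..N. \<Sum>n=1..N. c m n * I m n)) {T..2*T}"
    unfolding sq .
  moreover have "(\<lambda>t. (norm (P t))\<^sup>2) integrable_on {T..2*T}"
    unfolding P_def by (intro integrable_continuous_interval continuous_intros)
  then have "((\<lambda>t. complex_of_real ((norm (P t))\<^sup>2)) has_integral of_real (integral {T..2*T} (\<lambda>t. (norm (P t))\<^sup>2))) {T..2*T}"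
    by (intro has_integral_of_real integrable_integral)
  ultimately have int: "of_real (integral {T..2*T} (\<lambda>t. (norm (P t))\<^sup>2)) = (\<Sum>m=1..N. \<Sum>n=1..N. c m n * I m n)"
    using has_integral_unique by blast
  have diag: "of_real (T * (\<Sum>n=1..N. (norm (a n))\<^sup>2)) = (\<Sum>m=1..N. \<Sum>n=1..N. c m n * (if m = n then of_real T else 0))"
  proof -
    have "(\<Sum>m=1..N. \<Sum>n=1..N. c m n * (if m = n then of_real T else 0)) = (\<Sum>m=1..N. c m m * of_real T)"
      by (intro sum.cong refl) (simp add: if_distrib cong: if_cong)
    also have "\<dots> = (\<Sum>m=1..N. of_real (T * (norm (a m))\<^sup>2))"
      by (intro sum.cong refl) (simp only: c_def complex_norm_square[symmetric] of_real_mult mult.commute)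
    finally show ?thesis by (simp add: sum_distrib_left)
  qed
  have "\<bar>integral {T..2*T} (\<lambda>t. (norm (P t))\<^sup>2) - T * (\<Sum>n=1..N. (norm (a n))\<^sup>2)\<bar>
     = norm (complex_of_real (integral {T..2*T} (\<lambda>t. (norm (P t))\<^sup>2)) - of_real (T * (\<Sum>n=1..N. (norm (a n))\<^sup>2)))"
    unfolding of_real_diff[symmetric] norm_of_real ..
  also have "\<dots> = norm (\<Sum>m=1..N. \<Sum>n=1..N. c m n * (I m n - (if m = n then of_real T else 0)))"
    unfolding int diag by (simp add: sum_subtractf[symmetric] right_diff_distrib)
  also have "\<dots> \<le> (\<Sum>m=1..N. \<Sum>n=1..N. (norm (a m) * norm (a n)) * (2 * (real m * real n)))"
  proof (intro sum_norm_le)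
    fix m n assume mn: "m \<in> {1..N}" "n \<in> {1..N}"
    have "norm (I m n - (if m = n then of_real T else 0)) \<le> 2 * (real m * real n)"
    proof (cases "m = n")
      case True
      have "I m n = of_real T" using assms by (simp add: I_def True complex_eq_iff scaleR_conv_of_real)
      then show ?thesis using True by simp
    next
      case False
      have "norm (I m n) \<le> 2 / \<bar>ln (real m) - ln (real n)\<bar>"
        unfolding I_def using False mn assms by (intro norm_integral_cis_le) auto
      also have "\<dots> = 2 * (1 / \<bar>ln (real m) - ln (real n)\<bar>)" by simp
      also have "\<dots> \<le> 2 * (real m * real n)"
        using inverse_ln_diff_le[of m n] False mn by (intro mult_left_mono) auto
      finally show ?thesis using False by simp
    qed
    then show "norm (c m n * (I m n - (if m = n then of_real T else 0))) \<le> (norm (a m) * norm (a n)) * (2 * (real m * real n))"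
      unfolding norm_mult c_def complex_mod_cnj by (intro mult_left_mono) auto
  qed
  also have "\<dots> = 2 * (\<Sum>n=1..N. norm (a n) * real n)\<^sup>2"
    unfolding power2_eq_square sum_product by (simp add: sum_distrib_left mult_ac)
  finally show ?thesis unfolding P_def .
qed

section \<open>Approximation of powers of zeta\<close>

text \<open>The Mellin integral, cut at height H, of a smooth cutoff of n at X: close to 1 for n
  well below X and small well above.\<close>

definition smoothing_weight :: "real \<Rightarrow> real \<Rightarrow> nat \<Rightarrow> complex" where
  "smoothing_weight X H n = smoothed X H (\<lambda>w. of_nat n powr (-w))"

definition smoothing_error :: "real \<Rightarrow> real \<Rightarrow> real \<Rightarrow> real" where
  "smoothing_error X H \<alpha> = H / \<alpha> * X powr (-\<alpha>) + 2 * X powr 3 * exp (9 - H\<^sup>2)"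

text \<open>On the rectangle \<open>n powr (-w)\<close> has norm at most
  \<open>n powr \<alpha>\<close>. This factor is what brings in the diagonal sum at \<sigma> -
  \<alpha> when the weights are removed.\<close>

lemma smoothing_weight_approx:
  assumes "X \<ge> 1" "H \<ge> 1" "0 < \<alpha>" "\<alpha> \<le> 1" "n \<ge> 1"
  shows "norm (smoothing_weight X H n - 1) \<le> real n powr \<alpha> * smoothing_error X H \<alpha>"
proof -
  have "norm (smoothed X H (\<lambda>w. of_nat n powr (-w)) - of_nat n powr (-0)) \<le>
      real n powr \<alpha> * (H / \<alpha> * X powr (-\<alpha>) + 2 * X powr 3 * exp (9 - H\<^sup>2))"
  proof (rule smoothed_approx[where U = UNIV])
    show "(\<lambda>w. of_nat n powr (-w)) holomorphic_on UNIV"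
      using assms by (intro holomorphic_intros) auto
    fix w :: complex assume "Re w \<in> {-\<alpha>..3}"
    then show "norm (of_nat n powr (-w)) \<le> real n powr \<alpha>"
      using assms by (simp add: norm_powr_real_powr powr_mono)
  qed (use assms in auto)
  then show ?thesis using assms by (simp add: smoothing_weight_def smoothing_error_def)
qed

lemma norm_smoothing_weight_le:
  assumes "X > 0" "H \<ge> 0" "n \<ge> 1"
  shows "norm (smoothing_weight X H n) \<le> real n powr (-3) * (H * X powr 3 * exp 9)"
  unfolding smoothing_weight_def
proof (rule norm_smoothed_le)
  show "continuous_on (closed_segment (Complex 3 (-H)) (Complex 3 H)) (\<lambda>w. of_nat n powr (-w))"
    using assms by (intro continuous_intros) auto
qed (use assms in \<open>auto simp: norm_powr_real_powr\<close>)

text \<open>On the right edge the power of zeta is split into a Dirichlet polynomial, which yields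
  the smoothed sum, and a tail bounded by \<tau>. The shift to the left is applied to the power of
  zeta itself, the tail being small only where the series converges.\<close>

lemma zeta_power_approx:
  assumes "k \<ge> 1" "0 < \<sigma> - \<alpha>" "T > H" "X \<ge> 1" "H \<ge> 1" "0 < \<alpha>" "\<alpha> \<le> 1" "M \<ge> 0" "\<sigma> < 1"
    and t: "t \<in> {T..2*T}"
    and zb: "\<And>\<beta> u. \<sigma> - \<alpha> \<le> \<beta> \<Longrightarrow> T - H \<le> u \<Longrightarrow> u \<le> 2*T + H \<Longrightarrow> norm (zeta (Complex \<beta> u)) ^ k \<le> M"
    and tail: "\<And>s. Re s \<ge> 2 \<Longrightarrow>
       norm (zeta s ^ k - (\<Sum>n=1..N. of_real (dk (real k) n) * of_nat n powr (-s))) \<le> \<tau>"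
  shows "norm (zeta (Complex \<sigma> t) ^ k -
           (\<Sum>n=1..N. of_real (dk (real k) n) * of_nat n powr (- Complex \<sigma> t) * smoothing_weight X H n))
         \<le> M * smoothing_error X H \<alpha> + \<tau> * (H * X powr 3 * exp 9)"
proof -
  define s where "s = Complex \<sigma> t"
  define S where "S = closed_segment (Complex 3 (-H)) (Complex 3 H)"
  define \<gamma> where "\<gamma> = linepath (Complex 3 (-H)) (Complex 3 H)"
  \<comment> \<open>Convex, large enough for the rectangle because T > H and \<sigma> > \<alpha>,
    and such that s + w stays in the open first quadrant, away from the pole at 1.\<close>
  define U where "U = {w. Re w > - \<sigma>} \<inter> {w. Im w > - t}"
  define f where "f = (\<lambda>w. zeta (s + w) ^ k)"
  define q where "q = (\<lambda>n. of_real (dk (real k) n) * of_nat n powr (-s))"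
  define p where "p = (\<lambda>w. \<Sum>n=1..N. q n * of_nat n powr (-w))"
  have sub: "cbox (Complex (-\<alpha>) (-H)) (Complex 3 H) \<subseteq> U"
    using assms by (auto simp: U_def in_cbox_complex_iff)
  have holf: "f holomorphic_on U"
  proof -
    have "(zeta \<circ> (\<lambda>w. s + w)) holomorphic_on U"
    proof (rule holomorphic_on_compose_gen[OF _ zeta_holomorphic])
      show "(\<lambda>w. s + w) holomorphic_on U" by (intro holomorphic_intros)
      show "(\<lambda>w. s + w) ` U \<subseteq> {s. 0 < Re s} - {1}"
      proof (rule image_subsetI)
        fix w assume "w \<in> U"
        then have "Re (s + w) > 0" "Im (s + w) > 0" by (auto simp: U_def s_def)
        then show "s + w \<in> {s. 0 < Re s} - {1}" by (auto simp: complex_eq_iff)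
      qed
    qed
    then show ?thesis unfolding f_def o_def by (intro holomorphic_intros)
  qed
  have 1: "norm (smoothed X H f - f 0) \<le> M * smoothing_error X H \<alpha>"
    unfolding smoothing_error_def
  proof (rule smoothed_approx[OF _ _ _ _ _ _ _ sub holf])
    show "convex U" unfolding U_def by (intro convex_Int convex_halfspace_Re_gt convex_halfspace_Im_gt)
    show "open U" unfolding U_def by (intro open_Int open_halfspace_Re_gt open_halfspace_Im_gt)
    fix w assume w: "Re w \<in> {-\<alpha>..3}" "Im w \<in> {-H..H}"
    have "s + w = Complex (\<sigma> + Re w) (t + Im w)" by (simp add: s_def complex_eq_iff)
    then show "norm (f w) \<le> M" unfolding f_def norm_power using w t by (auto intro!: zb)
  qed (use assms in auto)
  have SU: "S \<subseteq> U"
    using sub closed_segment_subset[of "Complex 3 (-H)" "cbox (Complex (-\<alpha>) (-H)) (Complex 3 H)" "Complex 3 H"] assms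
    by (auto simp: S_def in_cbox_complex_iff)
  have contf: "continuous_on S f"
    using holf SU holomorphic_on_imp_continuous_on continuous_on_subset by blast
  have contn: "continuous_on S (\<lambda>w. complex_of_nat n powr (-w))" if "n \<ge> 1" for n
    using that by (intro continuous_intros) auto
  have contp: "continuous_on S p"
    unfolding p_def using contn by (intro continuous_intros) auto
  have p_eq: "p w = (\<Sum>n=1..N. of_real (dk (real k) n) * of_nat n powr (-(s + w)))" for w
    unfolding p_def q_def by (simp add: powr_add[symmetric] mult.assoc)
  have "smoothed X H f = smoothed X H (\<lambda>w. f w - p w) + smoothed X H p"
  proof -
    have "contour_integral \<gamma> (\<lambda>w. f w * smoothing_kernel X w) =
        contour_integral \<gamma> (\<lambda>w. (f w - p w) * smoothing_kernel X w + p w * smoothing_kernel X w)"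
      by (simp add: algebra_simps)
    also have "\<dots> = contour_integral \<gamma> (\<lambda>w. (f w - p w) * smoothing_kernel X w) +
        contour_integral \<gamma> (\<lambda>w. p w * smoothing_kernel X w)"
      unfolding \<gamma>_def using contf contp unfolding S_def
      by (intro contour_integral_add smoothed_integrable continuous_intros)
    finally show ?thesis unfolding smoothed_def \<gamma>_def by (simp add: add_divide_distrib)
  qed
  moreover have "smoothed X H p = (\<Sum>n=1..N. q n * smoothing_weight X H n)"
  proof -
    have int: "(\<lambda>w. q n * (of_nat n powr (-w) * smoothing_kernel X w)) contour_integrable_on \<gamma>" if "n \<in> {1..N}" for n
      unfolding \<gamma>_def using that contn[of n] unfolding S_def
      by (intro contour_integrable_lmul smoothed_integrable) auto
    have "contour_integral \<gamma> (\<lambda>w. p w * smoothing_kernel X w) =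
       contour_integral \<gamma> (\<lambda>w. \<Sum>n=1..N. q n * (of_nat n powr (-w) * smoothing_kernel X w))"
      unfolding p_def sum_distrib_right by (simp only: mult.assoc)
    also have "\<dots> = (\<Sum>n=1..N. contour_integral \<gamma> (\<lambda>w. q n * (of_nat n powr (-w) * smoothing_kernel X w)))"
      using int by (intro contour_integral_sum) auto
    also have "\<dots> = (\<Sum>n=1..N. q n * contour_integral \<gamma> (\<lambda>w. of_nat n powr (-w) * smoothing_kernel X w))"
    proof (intro sum.cong refl contour_integral_lmul)
      fix n assume "n \<in> {1..N}"
      then show "(\<lambda>w. of_nat n powr (-w) * smoothing_kernel X w) contour_integrable_on \<gamma>"
        unfolding \<gamma>_def using contn[of n] unfolding S_def by (intro smoothed_integrable) auto
    qed
    finally show ?thesis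
      unfolding smoothed_def smoothing_weight_def \<gamma>_def by (simp add: sum_divide_distrib)
  qed
  moreover have 2: "norm (smoothed X H (\<lambda>w. f w - p w)) \<le> \<tau> * (H * X powr 3 * exp 9)"
  proof (rule norm_smoothed_le)
    show "continuous_on (closed_segment (Complex 3 (-H)) (Complex 3 H)) (\<lambda>w. f w - p w)"
      using contf contp unfolding S_def by (intro continuous_intros)
    show *: "norm (f w - p w) \<le> \<tau>" if "Re w = 3" for w
      unfolding f_def p_eq using that assms by (intro tail) (auto simp: s_def)
    show "\<tau> \<ge> 0" using order_trans[OF norm_ge_zero tail[of 2]] by simp
  qed (use assms in auto)
  ultimately have "f 0 - (\<Sum>n=1..N. q n * smoothing_weight X H n)
     = smoothed X H (\<lambda>w. f w - p w) - (smoothed X H f - f 0)" by simp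
  then have "norm (f 0 - (\<Sum>n=1..N. q n * smoothing_weight X H n)) \<le>
      norm (smoothed X H (\<lambda>w. f w - p w)) + norm (smoothed X H f - f 0)"
    using norm_triangle_ineq4 by metis
  then show ?thesis using 1 2 by (simp add: f_def q_def s_def)
qed

section \<open>Moments under a pointwise bound\<close>

lemma nat_powr_neg_Complex:
  assumes "n \<ge> 1"
  shows "of_nat n powr (- Complex \<sigma> t) = of_real (real n powr (-\<sigma>)) * cis (- (t * ln (real n)))"
proof -
  have "Ln (of_nat n) = of_real (ln (real n))"
    using assms Ln_of_real[of "real n"] by simp
  then have "of_nat n powr (- Complex \<sigma> t) = exp (- Complex \<sigma> t * of_real (ln (real n)))"
    using assms by (simp add: powr_def)
  also have "- Complex \<sigma> t * of_real (ln (real n)) = of_real (-\<sigma> * ln (real n)) + \<i> * of_real (- (t * ln (real n)))"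
    by (simp add: complex_eq_iff)
  also have "exp \<dots> = of_real (exp (-\<sigma> * ln (real n))) * cis (- (t * ln (real n)))"
    by (simp only: exp_add exp_of_real cis_conv_exp)
  finally show ?thesis using assms by (simp add: powr_def)
qed

text \<open>The bound involves \<open>(norm d)^2\<close>, so that integrating it needs only the mean
  square of d; the linear term is absorbed by \<open>2 * |d| <= 1 + |d|^2\<close>.\<close>

lemma norm_square_perturb:
  fixes z d :: complex
  assumes "norm (z - d) \<le> \<epsilon>" "\<epsilon> \<le> 1"
  shows "\<bar>(norm z)\<^sup>2 - (norm d)\<^sup>2\<bar> \<le> \<epsilon> * (2 + (norm d)\<^sup>2)"
proof -
  have e0: "\<epsilon> \<ge> 0" using assms(1) norm_ge_zero order_trans by blast
  have d: "\<bar>norm z - norm d\<bar> \<le> \<epsilon>" using norm_triangle_ineq3[of z d] assms by linarith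
  have "(norm z)\<^sup>2 - (norm d)\<^sup>2 = (norm z - norm d) * (norm z + norm d)"
    by (simp add: power2_eq_square algebra_simps)
  then have "\<bar>(norm z)\<^sup>2 - (norm d)\<^sup>2\<bar> = \<bar>norm z - norm d\<bar> * (norm z + norm d)"
    by (simp add: abs_mult)
  also have "\<dots> \<le> \<epsilon> * (norm z + norm d)" using d by (intro mult_right_mono) auto
  also have "\<dots> \<le> \<epsilon> * (2 + (norm d)\<^sup>2)"
  proof (rule mult_left_mono[OF _ e0])
    have "(norm d - 1)\<^sup>2 \<ge> 0" by simp
    then have "2 * norm d \<le> 1 + (norm d)\<^sup>2" by (simp add: power2_eq_square algebra_simps)
    then show "norm z + norm d \<le> 2 + (norm d)\<^sup>2" using d assms(2) by linarith
  qed
  finally show ?thesis .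
qed

lemma sum_le_suminf_shift:
  fixes f :: "nat \<Rightarrow> real"
  assumes "summable (\<lambda>n. f (Suc n))" "\<And>n. f n \<ge> 0"
  shows "(\<Sum>n=1..N. f n) \<le> (\<Sum>n. f (Suc n))"
proof -
  have "(\<Sum>n=1..N. f n) = (\<Sum>n<N. f (Suc n))"
    using sum.shift_bounds_Suc_ivl[of f 0 N] by (simp add: atLeast0LessThan atLeastLessThanSuc_atLeastAtMost)
  then show ?thesis using assms by (simp add: sum_le_suminf)
qed

text \<open>The moment is compared with the mean square J/T of the smoothed polynomial, J/T with its
  diagonal Q, and Q with the unsmoothed sum. The respective costs are the contour error,
  \<open>off\<close> and the error of the weights.\<close>

lemma moment_near_diag_sum:
  assumes \<sigma>: "1/2 < \<sigma>" "\<sigma> < 1" and k: "k \<ge> 1" and \<alpha>: "0 < \<alpha>" "\<alpha> \<le> 1" "1/2 < \<sigma> - \<alpha>"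
    and T: "T > H" and X: "X \<ge> 1" and H: "H \<ge> 1" and M: "M \<ge> 1"
    and zb: "\<And>\<beta> u. \<sigma> - \<alpha> \<le> \<beta> \<Longrightarrow> T - H \<le> u \<Longrightarrow> u \<le> 2*T + H \<Longrightarrow> norm (zeta (Complex \<beta> u)) ^ k \<le> M"
    and \<eta>: "\<eta> = smoothing_error X H \<alpha>" and small: "2 * M * \<eta> \<le> 1"
    and off: "off = 2 * (H * X powr 3 * exp 9 * 3 ^ k)\<^sup>2 / T"
  shows "\<bar>moment \<sigma> k T - diag_sum \<sigma> k\<bar> \<le>
           2 * M * \<eta> * (2 + off + diag_sum \<sigma> k + 4 * \<eta> * diag_sum (\<sigma> - \<alpha>) k)
             + off + 4 * \<eta> * diag_sum (\<sigma> - \<alpha>) k"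
proof -
  define G where "G = diag_sum (\<sigma> - \<alpha>) k"
  have G1: "G \<ge> 1" unfolding G_def using \<sigma> \<alpha> k by (intro diag_sum_ge_1) auto
  have \<eta>0: "\<eta> > 0" unfolding \<eta> smoothing_error_def using X H \<alpha>
    by (intro add_pos_pos mult_pos_pos divide_pos_pos) auto
  have M\<eta>: "\<eta> \<le> M * \<eta>" using M \<eta>0 by simp
  have \<eta>1: "\<eta> \<le> 1" using small M\<eta> \<eta>0 by linarith
  have T0: "T > 0" using T H by simp
  define K where "K = H * X powr 3 * exp 9"
  have K0: "K > 0" using H X by (simp add: K_def)
  obtain \<tau> :: "nat \<Rightarrow> real" where \<tau>: "\<tau> \<longlonglongrightarrow> 0"
    "\<And>N s. Re s \<ge> 2 \<Longrightarrow>
       norm (zeta s ^ k - (\<Sum>n=1..N. of_real (dk (real k) n) * of_nat n powr (-s))) \<le> \<tau> N"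
    using zeta_power_tail[OF k] by blast
  define f where "f = (\<lambda>n. (dk (real k) n)\<^sup>2 / real n powr (2 * \<sigma>))"
  have f0: "f n \<ge> 0" for n by (simp add: f_def)
  have "(\<lambda>N. \<tau> N * K) \<longlonglongrightarrow> 0 * K" using \<tau>(1) by (intro tendsto_intros)
  then have ev1: "eventually (\<lambda>N. \<tau> N * K < \<eta>) sequentially"
    using \<eta>0 order_tendstoD(2) by fastforce
  have fs: "summable (\<lambda>n. f (Suc n))" using diag_summable[OF \<sigma> k] by (simp add: f_def)
  have "(\<lambda>N. \<Sum>n<N. f (Suc n)) \<longlonglongrightarrow> diag_sum \<sigma> k"
    using summable_LIMSEQ[OF fs] by (simp add: diag_sum_def f_def)
  then have ev2: "eventually (\<lambda>N. (\<Sum>n<N. f (Suc n)) > diag_sum \<sigma> k - \<eta>) sequentially"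
    using \<eta>0 by (intro order_tendstoD(1)) auto
  \<comment> \<open>N may depend on k and T, as none of the bounds below grows with it.\<close>
  obtain N where N: "\<tau> N * K < \<eta>" "(\<Sum>n<N. f (Suc n)) > diag_sum \<sigma> k - \<eta>"
    using eventually_happens[OF eventually_conj[OF ev1 ev2]] by auto
  define W where "W = smoothing_weight X H"
  define a where "a = (\<lambda>n. of_real (dk (real k) n * real n powr (-\<sigma>)) * W n)"
  define D where "D = (\<lambda>t. \<Sum>n=1..N. a n * cis (- (t * ln (real n))))"
  define z where "z = (\<lambda>t. zeta (Complex \<sigma> t) ^ k)"
  \<comment> \<open>The contour contributes M \<eta>, and the tail of the series at most \<eta> <= M
    \<eta>.\<close>
  define \<epsilon> where "\<epsilon> = 2 * M * \<eta>"
  have \<epsilon>: "0 \<le> \<epsilon>" "\<epsilon> \<le> 1" using small M \<eta>0 by (auto simp: \<epsilon>_def)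
  have zD: "norm (z t - D t) \<le> \<epsilon>" if t: "t \<in> {T..2*T}" for t
  proof -
    have D: "D t = (\<Sum>n=1..N. of_real (dk (real k) n) * of_nat n powr (- Complex \<sigma> t) * smoothing_weight X H n)"
      unfolding D_def by (intro sum.cong refl) (simp add: nat_powr_neg_Complex a_def W_def mult_ac)
    have "norm (z t - D t) \<le> M * smoothing_error X H \<alpha> + \<tau> N * (H * X powr 3 * exp 9)"
      unfolding D z_def using \<sigma> k \<alpha> T X H M t zb \<tau>(2) by (intro zeta_power_approx) auto
    then show ?thesis using N(1) M\<eta> by (simp add: \<epsilon>_def \<eta> K_def)
  qed
  have contz: "continuous_on {T..2*T} z"
    unfolding z_def using \<sigma> T0
    by (intro continuous_intros continuous_on_subset[OF zeta_continuous_line]) auto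
  have contD: "continuous_on {T..2*T} D" unfolding D_def by (intro continuous_intros)
  define J where "J = integral {T..2*T} (\<lambda>t. (norm (D t))\<^sup>2)"
  have mom: "moment \<sigma> k T = integral {T..2*T} (\<lambda>t. (norm (z t))\<^sup>2) / T"
    by (simp add: moment_def z_def norm_power power_mult[symmetric] mult.commute)
  have s1: "\<bar>moment \<sigma> k T - J / T\<bar> \<le> \<epsilon> * (2 + J / T)"
  proof -
    have i1: "(\<lambda>t. (norm (z t))\<^sup>2) integrable_on {T..2*T}" and i2: "(\<lambda>t. (norm (D t))\<^sup>2) integrable_on {T..2*T}"
      using contz contD by (auto intro!: integrable_continuous_interval continuous_intros)
    have "integral {T..2*T} (\<lambda>t. (norm (z t))\<^sup>2) - J = integral {T..2*T} (\<lambda>t. (norm (z t))\<^sup>2 - (norm (D t))\<^sup>2)"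
      unfolding J_def using i1 i2 by (simp add: integral_diff)
    also have "norm \<dots> \<le> integral {T..2*T} (\<lambda>t. \<epsilon> * (2 + (norm (D t))\<^sup>2))"
    proof (rule integral_norm_bound_integral)
      show "(\<lambda>t. (norm (z t))\<^sup>2 - (norm (D t))\<^sup>2) integrable_on {T..2*T}" using i1 i2 by (rule integrable_diff)
      show "(\<lambda>t. \<epsilon> * (2 + (norm (D t))\<^sup>2)) integrable_on {T..2*T}"
        using contD by (auto intro!: integrable_continuous_interval continuous_intros)
      show "norm ((norm (z t))\<^sup>2 - (norm (D t))\<^sup>2) \<le> \<epsilon> * (2 + (norm (D t))\<^sup>2)" if "t \<in> {T..2*T}" for t
        using norm_square_perturb[OF zD[OF that] \<epsilon>(2)] by simp
    qed
    also have "integral {T..2*T} (\<lambda>t. \<epsilon> * (2 + (norm (D t))\<^sup>2)) = \<epsilon> * (2 * T + J)"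
      using T0 integral_add[OF integrable_const_ivl[of 2 T "2*T"] i2] by (simp add: J_def)
    finally have "\<bar>integral {T..2*T} (\<lambda>t. (norm (z t))\<^sup>2) - J\<bar> / T \<le> \<epsilon> * (2 * T + J) / T"
      using T0 by (simp add: divide_right_mono)
    moreover have "\<bar>integral {T..2*T} (\<lambda>t. (norm (z t))\<^sup>2) - J\<bar> / T = \<bar>moment \<sigma> k T - J / T\<bar>"
      using T0 unfolding mom diff_divide_distrib[symmetric] by simp
    moreover have "\<epsilon> * (2 * T + J) / T = \<epsilon> * (2 + J / T)"
      using T0 by (simp add: field_simps)
    ultimately show ?thesis by simp
  qed
  define Q where "Q = (\<Sum>n=1..N. (norm (a n))\<^sup>2)"
  have s2: "\<bar>J / T - Q\<bar> \<le> off"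
  proof -
    have dk0: "dk (real k) n \<ge> 0" for n using dk_nonneg[OF k] .
    have "(\<Sum>n=1..N. norm (a n) * real n) \<le> (\<Sum>n=1..N. (dk (real k) n * real n powr (-2)) * K)"
    proof (rule sum_mono)
      fix n assume "n \<in> {1..N}"
      then have n: "n \<ge> 1" by simp
      have "norm (a n) * real n = dk (real k) n * (real n powr (-\<sigma>) * real n) * norm (W n)"
        using dk0 by (simp add: a_def norm_mult)
      also have "\<dots> \<le> dk (real k) n * (real n powr (-\<sigma>) * real n) * (real n powr (-3) * K)"
        unfolding W_def K_def using n X H dk0 by (intro mult_left_mono norm_smoothing_weight_le) auto
      \<comment> \<open>The powers of n combine to at most \<open>n powr (-2)\<close>, which leads
        to the series at 2 and hence to \<open>3 ^ k\<close>.\<close>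
      also have "\<dots> = dk (real k) n * (real n powr (-\<sigma>) * (real n powr 1 * real n powr (-3))) * K"
        using n by simp
      also have "\<dots> = dk (real k) n * real n powr (-\<sigma> + (1 + (-3))) * K"
        by (simp only: powr_add)
      also have "\<dots> \<le> dk (real k) n * real n powr (-2) * K"
        using n dk0 K0 \<sigma> by (intro mult_right_mono mult_left_mono powr_mono) auto
      finally show "norm (a n) * real n \<le> (dk (real k) n * real n powr (-2)) * K" .
    qed
    also have "\<dots> = (\<Sum>n=1..N. dk (real k) n * real n powr (-2)) * K" by (simp add: sum_distrib_right)
    also have "\<dots> \<le> 3 ^ k * K"
    proof (rule mult_right_mono)
      have "(\<Sum>n=1..N. dk (real k) n * real n powr (-2)) \<le> (\<Sum>n. dk (real k) (Suc n) * real (Suc n) powr (-2))"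
        using sums_summable[OF dk_series_at_2(1)[OF k]] dk0 by (intro sum_le_suminf_shift) auto
      also have "\<dots> = Re (zeta 2 ^ k)" using sums_unique[OF dk_series_at_2(1)[OF k]] by simp
      also have "\<dots> \<le> 3 ^ k" using dk_series_at_2(2)[OF k] .
      finally show "(\<Sum>n=1..N. dk (real k) n * real n powr (-2)) \<le> 3 ^ k" .
    qed (use K0 in auto)
    finally have S: "(\<Sum>n=1..N. norm (a n) * real n) \<le> 3 ^ k * K" .
    have "\<bar>J - T * Q\<bar> \<le> 2 * (\<Sum>n=1..N. norm (a n) * real n)\<^sup>2"
      unfolding J_def D_def Q_def using T0 by (rule dirichlet_polynomial_mean_square)
    also have "\<dots> \<le> 2 * (3 ^ k * K)\<^sup>2"
      using S by (intro mult_left_mono power_mono sum_nonneg) auto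
    finally have "\<bar>J - T * Q\<bar> / T \<le> 2 * (3 ^ k * K)\<^sup>2 / T" using T0 by (intro divide_right_mono) auto
    moreover have "J / T - Q = (J - T * Q) / T" using T0 by (simp add: field_simps)
    ultimately show ?thesis using T0 by (simp add: off K_def mult_ac)
  qed
  have s3: "\<bar>Q - diag_sum \<sigma> k\<bar> \<le> 4 * \<eta> * G"
  proof -
    \<comment> \<open>The summand at \<sigma> - \<alpha>: the deviation of \<open>|W n|^2\<close>
      from 1 is at most \<open>3 * \<eta> * n powr (2 * \<alpha>)\<close>, and the power of n lowers
      the exponent.\<close>
    define h where "h = (\<lambda>n. (dk (real k) n)\<^sup>2 / real n powr (2 * (\<sigma> - \<alpha>)))"
    have "Q - (\<Sum>n=1..N. f n) = (\<Sum>n=1..N. (norm (a n))\<^sup>2 - f n)" by (simp add: Q_def sum_subtractf)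
    also have "\<bar>\<dots>\<bar> \<le> (\<Sum>n=1..N. 3 * \<eta> * h n)"
    proof (rule order_trans[OF sum_abs], rule sum_mono)
      fix n assume "n \<in> {1..N}"
      then have n: "n \<ge> 1" by simp
      define r where "r = real n powr \<alpha>"
      have r1: "r \<ge> 1" unfolding r_def using n \<alpha> by (intro ge_one_powr_ge_zero) auto
      have W1: "norm (W n - 1) \<le> r * \<eta>"
        unfolding W_def r_def \<eta> using n X H \<alpha> by (intro smoothing_weight_approx) auto
      have "\<bar>norm (W n) - 1\<bar> \<le> r * \<eta>" using norm_triangle_ineq3[of "W n" 1] W1 by simp
      then have "\<bar>norm (W n) - 1\<bar> * (norm (W n) + 1) \<le> (r * \<eta>) * (2 + r * \<eta>)"
        using r1 \<eta>0 by (intro mult_mono) auto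
      also have "\<dots> = 2 * r * \<eta> + r\<^sup>2 * (\<eta> * \<eta>)" by (simp add: power2_eq_square algebra_simps)
      also have "\<dots> \<le> 2 * r\<^sup>2 * \<eta> + r\<^sup>2 * (\<eta> * 1)"
        using r1 \<eta>0 \<eta>1 self_le_power[of r 2] by (intro add_mono mult_right_mono mult_left_mono) auto
      finally have "\<bar>norm (W n) - 1\<bar> * (norm (W n) + 1) \<le> 3 * \<eta> * r\<^sup>2" by simp
      moreover have "\<bar>(norm (W n))\<^sup>2 - 1\<bar> = \<bar>norm (W n) - 1\<bar> * (norm (W n) + 1)"
      proof -
        have "(norm (W n))\<^sup>2 - 1 = (norm (W n) - 1) * (norm (W n) + 1)"
          by (simp add: power2_eq_square algebra_simps)
        then show ?thesis by (simp add: abs_mult)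
      qed
      ultimately have W2: "\<bar>(norm (W n))\<^sup>2 - 1\<bar> \<le> 3 * \<eta> * r\<^sup>2" by simp
      have na: "(norm (a n))\<^sup>2 = f n * (norm (W n))\<^sup>2"
      proof -
        have "(real n powr (-\<sigma>))\<^sup>2 = 1 / real n powr (2 * \<sigma>)"
          using n by (simp add: powr_power powr_minus_divide power_divide mult.commute)
        then show ?thesis by (simp add: a_def norm_mult power_mult_distrib f_def)
      qed
      have "\<bar>(norm (a n))\<^sup>2 - f n\<bar> = f n * \<bar>(norm (W n))\<^sup>2 - 1\<bar>"
        unfolding na using f0[of n] abs_mult[of "f n" "(norm (W n))\<^sup>2 - 1"] by (simp add: algebra_simps)
      also have "\<dots> \<le> f n * (3 * \<eta> * r\<^sup>2)" using W2 f0 by (rule mult_left_mono)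
      also have "\<dots> = 3 * \<eta> * h n"
      proof -
        have "r\<^sup>2 / real n powr (2 * \<sigma>) = 1 / real n powr (2 * (\<sigma> - \<alpha>))"
        proof -
          have "real n powr (2 * \<sigma>) = real n powr (2 * (\<sigma> - \<alpha>)) * r\<^sup>2"
            unfolding r_def using n by (simp add: powr_power powr_add[symmetric] algebra_simps)
          then show ?thesis using r1 by simp
        qed
        then have "(dk (real k) n)\<^sup>2 * (r\<^sup>2 / real n powr (2 * \<sigma>)) = h n" by (simp add: h_def)
        moreover have "f n * (3 * \<eta> * r\<^sup>2) = 3 * \<eta> * ((dk (real k) n)\<^sup>2 * (r\<^sup>2 / real n powr (2 * \<sigma>)))"
          by (simp add: f_def)
        ultimately show ?thesis by (simp only:)
      qed
      finally show "\<bar>(norm (a n))\<^sup>2 - f n\<bar> \<le> 3 * \<eta> * h n" .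
    qed
    also have "\<dots> = 3 * \<eta> * (\<Sum>n=1..N. h n)" by (simp add: sum_distrib_left)
    also have "\<dots> \<le> 3 * \<eta> * G"
    proof (rule mult_left_mono)
      show "(\<Sum>n=1..N. h n) \<le> G"
        unfolding G_def diag_sum_def h_def using \<sigma> \<alpha> k
        by (intro sum_le_suminf_shift diag_summable) auto
    qed (use \<eta>0 in auto)
    finally have "\<bar>Q - (\<Sum>n=1..N. f n)\<bar> \<le> 3 * \<eta> * G" .
    moreover have "\<bar>(\<Sum>n=1..N. f n) - diag_sum \<sigma> k\<bar> \<le> \<eta>"
    proof -
      have "(\<Sum>n=1..N. f n) \<le> diag_sum \<sigma> k"
        using sum_le_suminf_shift[OF fs f0, of N] by (simp add: diag_sum_def f_def)
      moreover have "(\<Sum>n=1..N. f n) = (\<Sum>n<N. f (Suc n))"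
        using sum.shift_bounds_Suc_ivl[of f 0 N] by (simp add: atLeast0LessThan atLeastLessThanSuc_atLeastAtMost)
      ultimately show ?thesis using N(2) by simp
    qed
    \<comment> \<open>The truncation at N costs one more \<eta>, whence 4 instead of 3.\<close>
    moreover have "\<eta> \<le> \<eta> * G" using G1 \<eta>0 by simp
    ultimately show ?thesis by linarith
  qed
  have "J / T \<le> off + diag_sum \<sigma> k + 4 * \<eta> * G" using s2 s3 by linarith
  then have "\<epsilon> * (2 + J / T) \<le> \<epsilon> * (2 + off + diag_sum \<sigma> k + 4 * \<eta> * G)"
    using \<epsilon>(1) by (intro mult_left_mono) auto
  then show ?thesis using s1 s2 s3 unfolding \<epsilon>_def G_def by linarith
qed

text \<open>\<open>LT\<close> is a real supremum, so it bounds its members only once the set is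
  known to be bounded above; the linear bound for zeta gives this. At a zero of zeta the claim is
  trivial.\<close>

lemma norm_zeta_le_exp_of_LT:
  assumes "LT T \<beta> \<le> B" "t \<in> {T..2*T}" "T \<ge> 1" "\<beta> \<ge> 1/4"
  shows "norm (zeta (Complex \<beta> t)) \<le> exp B"
proof (cases "zeta (Complex \<beta> t) = 0")
  case False
  have "bdd_above ((\<lambda>t. ln (cmod (zeta (Complex \<beta> t)))) ` {t. T \<le> t \<and> t \<le> 2*T \<and> zeta (Complex \<beta> t) \<noteq> 0})"
  proof (rule bdd_aboveI2)
    fix u assume u: "u \<in> {t. T \<le> t \<and> t \<le> 2*T \<and> zeta (Complex \<beta> t) \<noteq> 0}"
    have "norm (zeta (Complex \<beta> u)) \<le> 5 * norm (Complex \<beta> u)"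
      using u assms by (intro norm_zeta_le_linear) auto
    also have "\<dots> \<le> 5 * (\<beta> + 2 * T)"
      using cmod_le[of "Complex \<beta> u"] u assms by auto
    finally show "ln (cmod (zeta (Complex \<beta> u))) \<le> ln (5 * (\<beta> + 2 * T))"
      using u by (intro ln_mono) auto
  qed
  then have "ln (cmod (zeta (Complex \<beta> t))) \<le> LT T \<beta>"
    unfolding LT_def using assms False by (intro cSUP_upper) auto
  then have "ln (cmod (zeta (Complex \<beta> t))) \<le> B" using assms by simp
  then have "exp (ln (cmod (zeta (Complex \<beta> t)))) \<le> exp B" by simp
  then show ?thesis using False by simp
qed simp

text \<open>The cost of the shift is a constant: \<open>1 / (\<sigma> - \<alpha>)\<close> exceeds
  \<open>1 / \<sigma>\<close> by at most \<open>2 / ln L\<close>, and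
  \<open>k powr (2 / ln L) <= exp 2 <= 9\<close> for k <= L. The rest is
  \<open>k powr (1 / \<sigma>) <= c * (L / ln L)\<close>, from \<open>c / ln L <= 1\<close>,
  \<sigma> < 1 and \<delta> <= \<sigma>.\<close>

lemma powr_exponent_bound:
  fixes k L c \<sigma> \<delta> \<alpha> :: real
  assumes \<sigma>: "1/2 < \<sigma>" "\<sigma> < 1" "0 < \<delta>" "\<delta> \<le> \<sigma>" and c: "0 < c" "c \<le> 1"
    and L0: "L > 0" and LL: "ln L \<ge> 1" and \<alpha>: "\<alpha> = 1 / (2 * ln L)" "1/2 < \<sigma> - \<alpha>"
    and k: "1 \<le> k" "k \<le> c * L powr \<delta> / ln L"
  shows "k powr (1 / (\<sigma> - \<alpha>)) \<le> 9 * c * (L / ln L)"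
proof -
  have L1: "L \<ge> 1" using LL L0 by (smt (verit) ln_less_zero)
  have Lq: "L / ln L \<ge> 0" using L0 LL by (intro divide_nonneg_nonneg) linarith+
  have \<alpha>0: "\<alpha> > 0" using \<alpha> LL by simp
  have kL: "k \<le> L"
  proof -
    have "k \<le> c * L powr \<delta> / ln L" by fact
    also have "\<dots> \<le> 1 * L powr 1 / 1"
      using c LL L1 \<sigma> by (intro frac_le mult_mono powr_mono) auto
    finally show ?thesis using L0 by simp
  qed
  have e: "1 / (\<sigma> - \<alpha>) \<le> 1 / \<sigma> + 2 / ln L"
  proof -
    have "1 / (\<sigma> - \<alpha>) - 1 / \<sigma> = \<alpha> / (\<sigma> * (\<sigma> - \<alpha>))" using \<sigma> \<alpha> by (simp add: field_simps)
    also have "\<dots> \<le> \<alpha> / (1/2 * (1/2))"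
      using \<sigma>(1) \<alpha>(2) \<alpha>0 by (intro divide_left_mono mult_mono mult_pos_pos) auto
    also have "\<dots> = 2 / ln L" using \<alpha> by simp
    finally show ?thesis by simp
  qed
  have "k powr (1 / (\<sigma> - \<alpha>)) \<le> k powr (1 / \<sigma> + 2 / ln L)" using k e by (intro powr_mono) auto
  also have "\<dots> = k powr (1 / \<sigma>) * k powr (2 / ln L)" by (rule powr_add)
  also have "\<dots> \<le> (c * (L / ln L)) * 9"
  proof (rule mult_mono)
    have "k powr (2 / ln L) \<le> L powr (2 / ln L)" using k kL LL by (intro powr_mono2) auto
    also have "\<dots> = exp 2"
    proof -
      have "ln L \<noteq> 0" using LL by linarith
      then have "2 / ln L * ln L = 2" using nonzero_divide_eq_eq[of "ln L" 2 "2 / ln L"] by metis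
      then show ?thesis using L0 by (simp add: powr_def)
    qed
    also have "\<dots> = (exp 1)\<^sup>2" by (simp add: exp_double[symmetric] flip: exp_of_nat_mult)
    also have "\<dots> \<le> 3\<^sup>2" using exp_le by (intro power_mono) auto
    finally show "k powr (2 / ln L) \<le> 9" by simp
    have "k powr (1 / \<sigma>) \<le> (c / ln L * L powr \<delta>) powr (1 / \<sigma>)"
      using k \<sigma> by (intro powr_mono2) auto
    also have "\<dots> = (c / ln L) powr (1 / \<sigma>) * L powr (\<delta> / \<sigma>)"
      by (simp only: powr_mult powr_powr times_divide_eq_right mult_1_right)
    also have "\<dots> \<le> (c / ln L) powr 1 * L powr 1"
    proof (rule mult_mono)
      show "(c / ln L) powr (1 / \<sigma>) \<le> (c / ln L) powr 1"
        using c LL \<sigma> by (intro powr_mono') auto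
      show "L powr (\<delta> / \<sigma>) \<le> L powr 1" using L1 \<sigma> by (intro powr_mono) auto
    qed auto
    also have "\<dots> = c * (L / ln L)" using c LL L0 by simp
    finally show "k powr (1 / \<sigma>) \<le> c * (L / ln L)" .
  qed (use c mult_nonneg_nonneg[OF less_imp_le[OF c(1)] Lq] in auto)
  finally show ?thesis by (simp add: mult_ac)
qed

text \<open>For small c, both the pointwise bound for |zeta|^k and the diagonal sum at \<sigma> -
  \<alpha> are at most \<open>exp (log T / (160 * log log T))\<close>, whereas the smoothing error
  is about \<open>exp (- log T / (40 * log log T))\<close>. The products of the two therefore tend
  to 0.\<close>

lemma moment_asymp_of_LT_le:
  assumes \<sigma>: "1/2 < \<sigma>" "\<sigma> < 1" and \<delta>: "0 < \<delta>" "\<delta> \<le> \<sigma>"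
    and LT: "\<And>T \<beta>. T \<ge> T0 \<Longrightarrow> \<beta> \<ge> \<sigma> - 1 / ln (ln T) \<Longrightarrow> LT T \<beta> \<le> C * ln T powr (1 - \<delta>)"
  shows "\<exists>c>0. moment_asymp \<sigma> (\<lambda>T. c * ln T powr \<delta> / ln (ln T))"
proof -
  define C1 where "C1 = max C 1"
  have C1: "C1 \<ge> 1" "C \<le> C1" by (auto simp: C1_def)
  \<comment> \<open>Half the distance of \<sigma> from 1/2. For \<alpha> <= \<kappa> the point
    \<sigma> - \<alpha> stays at or above 1/2 + \<kappa>, so the single constant A serves all large
    T.\<close>
  define \<kappa> where "\<kappa> = (\<sigma> - 1/2) / 2"
  have \<kappa>: "\<kappa> > 0" "\<kappa> < 1" using \<sigma> by (auto simp: \<kappa>_def)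
  define A where "A = 16 / (1 - \<sigma>) + 4 / (2 * \<kappa>)"
  have A0: "A \<ge> 0" using \<sigma> \<kappa> by (simp add: A_def)
  \<comment> \<open>320 = 2 * 160 is for the exponent of |zeta|^k and 1440 = 9 * 160 for that of the
    diagonal sum, with the 9 of \<open>powr_exponent_bound\<close>.\<close>
  define c where "c = 1 / (320 * C1 + 1440 * A + 1)"
  have den: "320 * C1 + 1440 * A + 1 > 0" using C1 A0 by simp
  have c: "0 < c" "c \<le> 1" "2 * c * C1 \<le> 1/160" "9 * c * A \<le> 1/160"
    using den C1 A0 by (auto simp: c_def field_simps)
  \<comment> \<open>The square of X^3 divided by T is \<open>T powr (-7/10)\<close>, which leaves
    ample room for the other factors in \<open>off\<close>.\<close>
  define X where "X = (\<lambda>T::real. T powr (1/20))"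
  define \<alpha> where "\<alpha> = (\<lambda>T::real. 1 / (2 * ln (ln T)))"
  define \<eta> where "\<eta> = (\<lambda>T. smoothing_error (X T) (ln T) (\<alpha> T))"
  define M where "M = (\<lambda>T::real. exp (ln T / (160 * ln (ln T))))"
  \<comment> \<open>\<open>3 ^ k\<close> is replaced by a bound free of k, so that one limit serves
    all k in the range.\<close>
  define off where "off = (\<lambda>T. 2 * (ln T * X T powr 3 * exp 9 * exp (2 * (ln T / ln (ln T))))\<^sup>2 / T)"
  have lim1: "((\<lambda>T. M T * \<eta> T) \<longlongrightarrow> 0) at_top"
    unfolding M_def \<eta>_def smoothing_error_def X_def \<alpha>_def by real_asymp
  have lim2: "(off \<longlongrightarrow> 0) at_top"
    unfolding off_def X_def by real_asymp
  have "moment_asymp \<sigma> (\<lambda>T. c * ln T powr \<delta> / ln (ln T))"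
    unfolding moment_asymp_def
  proof (intro allI impI)
    fix \<epsilon> :: real assume \<epsilon>: "\<epsilon> > 0"
    \<comment> \<open>The errors will add up to at most 15 e times the diagonal sum, so 40 e is
      ample.\<close>
    define e where "e = min \<epsilon> 1 / 40"
    have e: "e > 0" "e \<le> 1 / 40" "40 * e \<le> \<epsilon>" using \<epsilon> by (auto simp: e_def)
    have "eventually (\<lambda>T. M T * \<eta> T < e) at_top" using lim1 e by (intro order_tendstoD) auto
    moreover have "eventually (\<lambda>T. off T < e) at_top" using lim2 e by (intro order_tendstoD) auto
    moreover have "eventually (\<lambda>T::real. ln (ln T) \<ge> 1) at_top" by real_asymp
    moreover have "eventually (\<lambda>T. \<alpha> T \<le> \<kappa>) at_top"
    proof -
      have "(\<alpha> \<longlongrightarrow> 0) at_top" unfolding \<alpha>_def by real_asymp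
      then have "eventually (\<lambda>T. \<alpha> T < \<kappa>) at_top" using \<kappa> by (intro order_tendstoD) auto
      then show ?thesis by eventually_elim simp
    qed
    moreover have "eventually (\<lambda>T::real. ln T \<le> T / 2) at_top" by real_asymp
    moreover have "eventually (\<lambda>T::real. ln (2 * T) \<le> 2 * ln T) at_top" by real_asymp
    moreover have "eventually (\<lambda>T::real. ln (ln (2 * T)) \<le> 2 * ln (ln T)) at_top" by real_asymp
    moreover have "eventually (\<lambda>T::real. ln (ln (T / 2)) > 0) at_top" by real_asymp
    moreover have "eventually (\<lambda>T::real. ln (T / 2) > 0) at_top" by real_asymp
    moreover have "eventually (\<lambda>T::real. T \<ge> max 2 (2 * T0)) at_top" by (rule eventually_ge_at_top)
    ultimately have "eventually (\<lambda>T. \<forall>k::nat. 1 \<le> k \<and> real k \<le> c * ln T powr \<delta> / ln (ln T) \<longrightarrow>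
        \<bar>moment \<sigma> k T - diag_sum \<sigma> k\<bar> \<le> \<epsilon> * diag_sum \<sigma> k) at_top"
    proof eventually_elim
      case (elim T)
      note big = elim
      define L where "L = ln T"
      have T2: "T \<ge> 2" "T / 2 \<ge> T0" using big(10) by auto
      have LL: "ln L \<ge> 1" using big(3) by (simp add: L_def)
      have L0: "L > 0" unfolding L_def using T2 by (intro ln_gt_zero) auto
      have L1: "L \<ge> 1" using LL L0 by (smt (verit) ln_less_zero)
      have Lq: "L / ln L \<ge> 0" using L0 LL by (intro divide_nonneg_nonneg) linarith+
      have \<alpha>T: "0 < \<alpha> T" "\<alpha> T \<le> 1" "\<alpha> T \<le> \<kappa>" "\<alpha> T = 1 / (2 * ln L)"
        using LL big(4) \<kappa> by (auto simp: \<alpha>_def L_def)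
      have s\<alpha>: "2 * (\<sigma> - \<alpha> T) - 1 \<ge> 2 * \<kappa>" "1/2 < \<sigma> - \<alpha> T"
        using \<alpha>T(3) \<kappa> by (auto simp: \<kappa>_def)
      have \<eta>0: "\<eta> T \<ge> 0" unfolding \<eta>_def smoothing_error_def using L0 \<alpha>T
        by (intro add_nonneg_nonneg mult_nonneg_nonneg divide_nonneg_nonneg) (auto simp: L_def)
      have M1: "M T \<ge> 1"
        unfolding M_def one_le_exp_iff using L1 LL by (intro divide_nonneg_nonneg) (auto simp: L_def)
      show ?case
      proof (intro allI impI)
        fix k :: nat assume k: "1 \<le> k \<and> real k \<le> c * ln T powr \<delta> / ln (ln T)"
        have kL: "real k * L powr (1 - \<delta>) \<le> c * (L / ln L)"
        proof -
          have "real k * L powr (1 - \<delta>) \<le> (c * L powr \<delta> / ln L) * L powr (1 - \<delta>)"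
            using k by (intro mult_right_mono) (auto simp: L_def)
          also have "\<dots> = c * (L powr (\<delta> + (1 - \<delta>)) / ln L)" unfolding powr_add by simp
          finally show ?thesis using L0 by simp
        qed
        have zb: "norm (zeta (Complex \<beta> u)) ^ k \<le> M T"
          if \<beta>: "\<sigma> - \<alpha> T \<le> \<beta>" and u: "T - ln T \<le> u" "u \<le> 2*T + ln T" for \<beta> u
        proof -
          \<comment> \<open>The contour around [T, 2T] stays in [T/2, 4T], covered by the windows
            [T', 2T'] with T' = T/2, T, 2T.\<close>
          have u': "T / 2 \<le> u" "u \<le> 4 * T" using u big(5) T2 by linarith+
          obtain T' where T': "T / 2 \<le> T'" "T' \<le> 2 * T" "u \<in> {T'..2*T'}"
          proof -
            consider "u \<le> T" | "T \<le> u" "u \<le> 2 * T" | "2 * T \<le> u" by linarith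
            then show ?thesis
            proof cases
              case 1 then show ?thesis using u' T2 by (intro that[of "T / 2"]) auto
            next
              case 2 then show ?thesis using u' T2 by (intro that[of T]) auto
            next
              case 3 then show ?thesis using u' T2 by (intro that[of "2 * T"]) auto
            qed
          qed
          have lnT': "ln (T / 2) \<le> ln T'" "ln T' \<le> ln (2 * T)"
            using T' T2 by (auto intro!: ln_mono)
          have lnT'0: "ln T' > 0" using lnT' big(9) by linarith
          have llT': "ln (ln (T / 2)) \<le> ln (ln T')" "ln (ln T') \<le> ln (ln (2 * T))"
            using lnT' big(9) lnT'0 by (auto intro!: ln_mono)
          \<comment> \<open>The factor 2 in \<alpha> is spent here:
            \<open>ln (ln T') <= 2 * ln (ln T)\<close> puts \<beta> within the range of the
            hypothesis at T'.\<close>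
          have "\<alpha> T \<le> 1 / ln (ln T')"
            unfolding \<alpha>_def using llT' big(7,8) LL by (intro divide_left_mono mult_pos_pos) (auto simp: L_def)
          then have "LT T' \<beta> \<le> C * ln T' powr (1 - \<delta>)"
            using T' T2 \<beta> by (intro LT) auto
          also have "\<dots> \<le> C1 * ln T' powr (1 - \<delta>)" using C1 by (intro mult_right_mono) auto
          also have "\<dots> \<le> C1 * (2 * L) powr (1 - \<delta>)"
            using C1 lnT' lnT'0 big(6) \<delta> \<sigma> by (intro mult_left_mono powr_mono2) (auto simp: L_def)
          also have "\<dots> = C1 * (2 powr (1 - \<delta>) * L powr (1 - \<delta>))" using L0 by (simp add: powr_mult)
          also have "\<dots> \<le> C1 * (2 powr 1 * L powr (1 - \<delta>))"
            using C1 \<delta> by (intro mult_left_mono mult_right_mono powr_mono) auto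
          finally have "LT T' \<beta> \<le> 2 * C1 * L powr (1 - \<delta>)" by simp
          then have "norm (zeta (Complex \<beta> u)) \<le> exp (2 * C1 * L powr (1 - \<delta>))"
            using T' T2 \<beta> s\<alpha> by (intro norm_zeta_le_exp_of_LT[of T']) auto
          then have "norm (zeta (Complex \<beta> u)) ^ k \<le> exp (2 * C1 * L powr (1 - \<delta>)) ^ k"
            by (intro power_mono) auto
          also have "\<dots> = exp (2 * C1 * (real k * L powr (1 - \<delta>)))"
            by (simp add: exp_of_nat_mult[symmetric] mult_ac)
          also have "\<dots> \<le> exp (2 * C1 * (c * (L / ln L)))"
            using kL C1 by (subst exp_le_cancel_iff, intro mult_left_mono) auto
          also have "\<dots> = exp ((2 * c * C1) * (L / ln L))" by (simp add: mult_ac)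
          also have "\<dots> \<le> exp (1/160 * (L / ln L))"
            using c(3) Lq by (subst exp_le_cancel_iff, intro mult_right_mono) auto
          also have "\<dots> = M T" by (simp add: M_def L_def)
          finally show ?thesis .
        qed
        have G: "diag_sum (\<sigma> - \<alpha> T) k \<le> M T"
        proof -
          have "diag_sum (\<sigma> - \<alpha> T) k \<le> exp ((16 / (1 - (\<sigma> - \<alpha> T)) + 4 / (2 * (\<sigma> - \<alpha> T) - 1)) * real k powr (1 / (\<sigma> - \<alpha> T)))"
            using s\<alpha> \<sigma> \<alpha>T(1-3) k by (intro diag_sum_le) auto
          also have "\<dots> \<le> exp (A * (9 * c * (L / ln L)))"
          proof (subst exp_le_cancel_iff, rule mult_mono)
            show "16 / (1 - (\<sigma> - \<alpha> T)) + 4 / (2 * (\<sigma> - \<alpha> T) - 1) \<le> A"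
              unfolding A_def using s\<alpha> \<sigma> \<alpha>T(1-3) \<kappa> by (intro add_mono divide_left_mono mult_pos_pos) auto
            show "real k powr (1 / (\<sigma> - \<alpha> T)) \<le> 9 * c * (L / ln L)"
              using powr_exponent_bound[OF \<sigma> \<delta> c(1,2) L0 LL \<alpha>T(4) s\<alpha>(2), of "real k"] k by (simp add: L_def)
          qed (use A0 in auto)
          also have "\<dots> = exp ((9 * c * A) * (L / ln L))" by (simp add: mult_ac)
          also have "\<dots> \<le> exp (1/160 * (L / ln L))"
            using c(4) Lq by (subst exp_le_cancel_iff, intro mult_right_mono) auto
          also have "\<dots> = M T" by (simp add: M_def L_def)
          finally show ?thesis .
        qed
        define o' where "o' = 2 * (ln T * X T powr 3 * exp 9 * 3 ^ k)\<^sup>2 / T"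
        have o': "0 \<le> o'" "o' \<le> off T"
        proof -
          show "0 \<le> o'" using T2 by (simp add: o'_def)
          have "real k \<le> L / ln L"
          proof -
            have "real k * 1 \<le> real k * L powr (1 - \<delta>)"
              using L1 \<delta> \<sigma> by (intro mult_left_mono ge_one_powr_ge_zero) auto
            also have "\<dots> \<le> c * (L / ln L)" by (rule kL)
            also have "\<dots> \<le> 1 * (L / ln L)" using c Lq by (intro mult_right_mono) auto
            finally show ?thesis by simp
          qed
          have "(3::real) ^ k \<le> exp 2 ^ k" using exp_ge_add_one_self[of "2::real"] by (intro power_mono) auto
          also have "\<dots> = exp (2 * real k)" by (simp add: exp_of_nat_mult[symmetric] mult.commute)
          also have "\<dots> \<le> exp (2 * (L / ln L))" using \<open>real k \<le> L / ln L\<close> by (subst exp_le_cancel_iff) auto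
          finally show "o' \<le> off T"
            unfolding o'_def off_def using T2 L0
            by (intro divide_right_mono mult_left_mono power_mono) (auto simp: L_def)
        qed
        have D1: "diag_sum \<sigma> k \<ge> 1" using diag_sum_ge_1[OF \<sigma>] k by simp
        have Me: "M T * \<eta> T \<le> e" using big(1) by simp
        have "\<bar>moment \<sigma> k T - diag_sum \<sigma> k\<bar> \<le>
           2 * M T * \<eta> T * (2 + o' + diag_sum \<sigma> k + 4 * \<eta> T * diag_sum (\<sigma> - \<alpha> T) k)
             + o' + 4 * \<eta> T * diag_sum (\<sigma> - \<alpha> T) k"
        proof (rule moment_near_diag_sum[where H = "ln T" and X = "X T" and \<eta> = "\<eta> T"])
          show "T > ln T" using big(5) T2 by linarith
          show "X T \<ge> 1" unfolding X_def using T2 by (intro ge_one_powr_ge_zero) auto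
          show "2 * M T * \<eta> T \<le> 1" using Me e by simp
        qed (use \<sigma> k \<alpha>T(1-3) s\<alpha> L1 M1 zb in \<open>auto simp: L_def \<eta>_def o'_def\<close>)
        also have "4 * \<eta> T * diag_sum (\<sigma> - \<alpha> T) k \<le> 4 * e"
        proof -
          have "\<eta> T * diag_sum (\<sigma> - \<alpha> T) k \<le> \<eta> T * M T" using G \<eta>0 by (rule mult_left_mono)
          then show ?thesis using Me by (simp add: mult.commute)
        qed
        finally have "\<bar>moment \<sigma> k T - diag_sum \<sigma> k\<bar> \<le>
           2 * M T * \<eta> T * (2 + o' + diag_sum \<sigma> k + 4 * e) + o' + 4 * e"
          using M1 \<eta>0 by (smt (verit) mult_left_mono mult_nonneg_nonneg)
        also have "\<dots> \<le> 2 * e * (2 + 1 + diag_sum \<sigma> k + 1) + e + 4 * e"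
        proof (intro add_mono)
          show oe: "o' \<le> e" using o' big(2) by linarith
          show "2 * M T * \<eta> T * (2 + o' + diag_sum \<sigma> k + 4 * e) \<le> 2 * e * (2 + 1 + diag_sum \<sigma> k + 1)"
            by (rule mult_mono) (use oe Me e D1 o' in auto)
        qed simp
        also have "\<dots> \<le> 40 * e * diag_sum \<sigma> k"
        proof -
          have "e * 1 \<le> e * diag_sum \<sigma> k" using D1 e by (intro mult_left_mono) auto
          moreover have "2 * e * (2 + 1 + diag_sum \<sigma> k + 1) + e + 4 * e = 13 * e + 2 * (e * diag_sum \<sigma> k)"
            by (simp add: algebra_simps)
          moreover have "40 * e * diag_sum \<sigma> k = 40 * (e * diag_sum \<sigma> k)" by simp
          ultimately show ?thesis using e(1) by linarith
        qed
        also have "\<dots> \<le> \<epsilon> * diag_sum \<sigma> k" using e D1 by (intro mult_right_mono) auto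
        finally show "\<bar>moment \<sigma> k T - diag_sum \<sigma> k\<bar> \<le> \<epsilon> * diag_sum \<sigma> k" .
      qed
    qed
    then show "\<exists>T0. \<forall>T\<ge>T0. \<forall>k::nat. 1 \<le> k \<and> real k \<le> c * ln T powr \<delta> / ln (ln T) \<longrightarrow>
        \<bar>moment \<sigma> k T - diag_sum \<sigma> k\<bar> \<le> \<epsilon> * diag_sum \<sigma> k"
      by (simp add: eventually_at_top_linorder)
  qed
  then show ?thesis using c(1) by blast
qed

theorem theorem1p4:
  fixes \<sigma> \<delta> :: real
  assumes "1/2 < \<sigma>" "\<sigma> < 1" "0 < \<delta>" "\<delta> \<le> \<sigma>"
  shows "(moment_asymp \<sigma> (\<lambda>T. ln T powr \<delta>) \<longrightarrow>
            (\<exists>C T0. \<forall>T\<ge>T0. LT T \<sigma> \<le> C * ln T powr (1 - \<delta>)))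
       \<and> ((\<exists>C T0. \<forall>T\<ge>T0. \<forall>\<beta>. \<beta> \<ge> \<sigma> - 1 / ln (ln T) \<longrightarrow> LT T \<beta> \<le> C * ln T powr (1 - \<delta>))
            \<longrightarrow> (\<exists>c>0. moment_asymp \<sigma> (\<lambda>T. c * ln T powr \<delta> / ln (ln T))))"
  using LT_le_of_moment_asymp[OF assms] moment_asymp_of_LT_le[OF assms] by blast

end
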